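(* Fix $\hat t\in[0,T)$ and $a_{\hat t}\in\Lambda_{\hat t}$. Let $g^{a_{\hat t}}$ and $S^{a_{\hat t}}$ denote the functionals on $\Lambda^{\hat t}$ given, for $(t,\gamma_t)\in[\hat t,T]\times\Lambda^{\hat t}$, by $g^{a_{\hat t}}(\gamma_t)=\int_0^t|\gamma_t(s)-a_{\hat t,t}(s)|^2ds$ and $S^{a_{\hat t}}(\gamma_t)=S(\gamma_t,a_{\hat t,t})$ (the restrictions to $\Lambda^{\hat t}$ of the functionals given by the same formulas on $\hat\Lambda^{\hat t}$). Then $g^{a_{\hat t}}\in C^1(\Lambda^{\hat t})$ and $S^{a_{\hat t}}\in C^1(\Lambda^{\hat t})$. Moreover, if $X:[0,T]\to R^d$ is continuous on $[0,T]$ and absolutely continuous on $[\hat t,T]$, then, writing $X_s=X|_{[0,s]}$, $$g^{a_{\hat t}}(X_s)=g^{a_{\hat t}}(X_{\hat t})+\int_{\hat t}^s|X(\sigma)-a_{\hat t}(\hat t)|^2d\sigma,\qquad s\in[\hat t,T],$$ and $$S^{a_{\hat t}}(X_s)=S^{a_{\hat t}}(X_{\hat t})+\int_{\hat t}^s\partial_xS^{a_{\hat t}}(X_\sigma)\,dX(\sigma),\qquad s\in[\hat t,T],$$ where $\partial_xS^{a_{\hat t}}=(\partial_{x_1}S^{a_{\hat t}},\dots,\partial_{x_d}S^{a_{\hat t}})$ with $$\partial_{x_i}S^{a_{\hat t}}(\gamma_t)=-\frac{4(\|\gamma_t-a_{\hat t,t}\|_0^2-|\gamma_t(t)-a_{\hat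 t}(\hat t)|^2)(\gamma_t^i(t)-a^i_{\hat t}(\hat t))}{\|\gamma_t-a_{\hat t,t}\|_0^2}$$ if $\|\gamma_t-a_{\hat t,t}\|_0\ne0$ and $\partial_{x_i}S^{a_{\hat t}}(\gamma_t)=0$ if $\|\gamma_t-a_{\hat t,t}\|_0=0$, for $i=1,\dots,d$ (the superscript $i$ denotes the $i$-th coordinate).
   Context: Fix $T>0$ and $d\ge1$. For $t\in[0,T]$, $\hat\Lambda_t$ is the set of càdlàg functions $[0,t]\to R^d$ and $\Lambda_t=C([0,t];R^d)$; $\hat\Lambda^t=\bigcup_{s\in[t,T]}\hat\Lambda_s$, $\Lambda^t=\bigcup_{s\in[t,T]}\Lambda_s$. A path in $\hat\Lambda_t$ is written $\gamma_t$ (the subscript is the final time), with value $\gamma_t(s)$ at $s\le t$; $(s,\gamma_s)\in[t,T]\times\Lambda^t$ means $s\in[t,T]$, $\gamma_s\in\Lambda_s$ (similarly for $\hat\Lambda^t$). For $t\le\bar t\le T$, $\gamma_{t,\bar t}\in\hat\Lambda_{\bar t}$ equals $\gamma_t$ on $[0,t]$ and $\gamma_t(t)$ on $(t,\bar t]$; for $x\in R^d$, $\gamma_t^x$ equals $\gamma_t$ on $[0,t)$ and $\gamma_t(t)+x$ at $t$. $\|\gamma_t\|_0=\sup_{0\le s\le t}|\gamma_t(s)|$ and, for $t\le\bar t$, $d_\infty(\gamma_t,\bar\gamma_{\bar t})=|t-\bar t|+\sup_{0\le s\le\bar t}|\gamma_{t,\bar t}(s)-\bar\gamma_{\bar t}(s)|$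 (extended symmetrically). For $\gamma_t,\gamma'_t\in\hat\Lambda_t$, $S(\gamma_t,\gamma'_t)=\dfrac{(\|\gamma_t-\gamma'_t\|_0^2-|\gamma_t(t)-\gamma'_t(t)|^2)^2}{\|\gamma_t-\gamma'_t\|_0^2}$ if $\|\gamma_t-\gamma'_t\|_0\ne0$ and $S(\gamma_t,\gamma'_t)=0$ otherwise. For $f:\hat\Lambda^t\to R$: the horizontal derivative is $\partial_tf(\gamma_s)=\lim_{h\downarrow0}\frac1h[f(\gamma_{s,s+h})-f(\gamma_s)]$ for $s<T$, and $\partial_tf(\gamma_T)=\lim_{s\uparrow T,\,s<T}\partial_tf(\gamma_T|_{[0,s]})$; the vertical derivative is $\partial_xf=(\partial_{x_1}f,\dots,\partial_{x_d}f)$ (a row vector), $\partial_{x_i}f(\gamma_s)=\lim_{h\to0}\frac1h[f(\gamma_s^{he_i})-f(\gamma_s)]$, $e_i$ the standard basis. $C^0(\hat\Lambda^t)$ is the set of $d_\infty$-continuous real functionals; $C^1(\hat\Lambda^t)$ is the set of $f\in C^0(\hat\Lambda^t)$ such that $\partial_tf,\partial_{x_1}f,\dots,\partial_{x_d}f$ exist on all of $\hat\Lambda^t$ and lie in $C^0(\hat\Lambda^t)$. $f\in C^1(\Lambda^t)$ means $f$ is the restriction to $\Lambda^t$ of some $\hat f\in C^1(\hat\Lambda^t)$; then $\partial_tf:=\partial_t\hat f$, $\partial_xf:=\partial_x\hat f$ on $\Lambda^t$ (independent of the choice of $\hat f$). *)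

theory Defs
  imports "HOL-Analysis.Analysis"
begin

text \<open>
  A path with final time \<open>t\<close> is a pair \<open>(t, \<gamma>)\<close> whose second component is extensional on
  \<open>{0..t}\<close>, so that two such pairs are equal iff they are the same function on \<open>[0, t]\<close>.
  The dimension is the cardinality of the index type \<open>'n\<close>.
\<close>

type_synonym 'n path = "real \<times> (real \<Rightarrow> real^'n)"

definition cadlag_paths :: "real \<Rightarrow> (real \<Rightarrow> real^'n) set" where
  "cadlag_paths t = {\<gamma> \<in> extensional {0..t}.
     (\<forall>s\<in>{0..<t}. (\<gamma> \<longlongrightarrow> \<gamma> s) (at_right s)) \<and>
     (\<forall>s\<in>{0<..t}. \<exists>l. (\<gamma> \<longlongrightarrow> l) (at_left s))}"

definition cont_paths :: "real \<Rightarrow> (real \<Rightarrow> real^'n) set" where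
  "cont_paths t = {\<gamma> \<in> extensional {0..t}. continuous_on {0..t} \<gamma>}"

definition cadlag_space :: "real \<Rightarrow> real \<Rightarrow> 'n::finite path set" where
  "cadlag_space T t = (SIGMA s:{t..T}. cadlag_paths s)"

definition cont_space :: "real \<Rightarrow> real \<Rightarrow> 'n::finite path set" where
  "cont_space T t = (SIGMA s:{t..T}. cont_paths s)"

text \<open>The path \<open>\<gamma>\<^bsub>t,u\<^esub>\<close>, frozen at its final value on \<open>(t, u]\<close>.\<close>

definition extend :: "real \<Rightarrow> (real \<Rightarrow> real^'n) \<Rightarrow> real \<Rightarrow> real \<Rightarrow> real^'n" where
  "extend t \<gamma> u = restrict (\<lambda>s. if s \<le> t then \<gamma> s else \<gamma> t) {0..u}"

definition bump :: "real \<Rightarrow> (real \<Rightarrow> real^'n) \<Rightarrow> real^'n \<Rightarrow> real \<Rightarrow> real^'n" where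
  "bump t \<gamma> x = \<gamma>(t := \<gamma> t + x)"

definition sup_norm :: "real \<Rightarrow> (real \<Rightarrow> real^'n) \<Rightarrow> real" where
  "sup_norm t \<gamma> = (SUP s\<in>{0..t}. norm (\<gamma> s))"

text \<open>
  Extending both paths to the larger of the two final times gives the symmetric extension of
  the distance; the path that already lives up to that time is left unchanged.
\<close>

definition d_infty :: "'n::finite path \<Rightarrow> 'n path \<Rightarrow> real" where
  "d_infty = (\<lambda>(t, \<gamma>) (t', \<gamma>').
     \<bar>t - t'\<bar> + sup_norm (max t t')
       (\<lambda>s. extend t \<gamma> (max t t') s - extend t' \<gamma>' (max t t') s))"

definition has_horizontal_deriv0 :: "('n::finite path \<Rightarrow> real) \<Rightarrow> 'n path \<Rightarrow> real \<Rightarrow> bool" where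
  "has_horizontal_deriv0 f = (\<lambda>(s, \<gamma>) D.
     ((\<lambda>h. (f (s + h, extend s \<gamma> (s + h)) - f (s, \<gamma>)) / h) \<longlongrightarrow> D) (at_right 0))"

text \<open>
  At the terminal time the horizontal derivative is the limit of the horizontal derivatives
  of the restrictions to \<open>[0, r]\<close>, \<open>r \<up> T\<close>.
\<close>

definition has_horizontal_deriv :: "real \<Rightarrow> ('n::finite path \<Rightarrow> real) \<Rightarrow> 'n path \<Rightarrow> real \<Rightarrow> bool" where
  "has_horizontal_deriv T f = (\<lambda>(s, \<gamma>) D.
     if s < T then has_horizontal_deriv0 f (s, \<gamma>) D
     else \<exists>\<phi>. (\<forall>\<^sub>F r in at_left T. has_horizontal_deriv0 f (r, restrict \<gamma> {0..r}) (\<phi> r)) \<and>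
              (\<phi> \<longlongrightarrow> D) (at_left T))"

definition has_vertical_deriv ::
    "('n::finite path \<Rightarrow> real) \<Rightarrow> 'n \<Rightarrow> 'n path \<Rightarrow> real \<Rightarrow> bool" where
  "has_vertical_deriv f i = (\<lambda>(s, \<gamma>) D.
     ((\<lambda>h. (f (s, bump s \<gamma> (h *\<^sub>R axis i 1)) - f (s, \<gamma>)) / h) \<longlongrightarrow> D) (at 0))"

definition horizontal_deriv :: "real \<Rightarrow> ('n::finite path \<Rightarrow> real) \<Rightarrow> 'n path \<Rightarrow> real" where
  "horizontal_deriv T f p = (THE D. has_horizontal_deriv T f p D)"

definition vertical_deriv :: "('n::finite path \<Rightarrow> real) \<Rightarrow> 'n path \<Rightarrow> real^'n" where
  "vertical_deriv f p = (\<chi> i. THE D. has_vertical_deriv f i p D)"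

definition C0_cadlag :: "real \<Rightarrow> real \<Rightarrow> ('n::finite path \<Rightarrow> real) set" where
  "C0_cadlag T t = {f. \<forall>p\<in>cadlag_space T t. \<forall>\<epsilon>>0. \<exists>\<delta>>0. \<forall>q\<in>cadlag_space T t.
     d_infty p q < \<delta> \<longrightarrow> \<bar>f q - f p\<bar> < \<epsilon>}"

definition C1_cadlag :: "real \<Rightarrow> real \<Rightarrow> ('n::finite path \<Rightarrow> real) set" where
  "C1_cadlag T t = {f \<in> C0_cadlag T t.
     (\<forall>p\<in>cadlag_space T t. \<exists>D. has_horizontal_deriv T f p D) \<and>
     (\<forall>i. \<forall>p\<in>cadlag_space T t. \<exists>D. has_vertical_deriv f i p D) \<and>
     horizontal_deriv T f \<in> C0_cadlag T t \<and>
     (\<forall>i. (\<lambda>p. vertical_deriv f p $ i) \<in> C0_cadlag T t)}"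

definition C1_extension ::
    "real \<Rightarrow> real \<Rightarrow> ('n::finite path \<Rightarrow> real) \<Rightarrow> ('n path \<Rightarrow> real) \<Rightarrow> bool" where
  "C1_extension T t f g \<longleftrightarrow> g \<in> C1_cadlag T t \<and> (\<forall>p\<in>cont_space T t. f p = g p)"

definition C1_cont :: "real \<Rightarrow> real \<Rightarrow> ('n::finite path \<Rightarrow> real) set" where
  "C1_cont T t = {f. \<exists>g. C1_extension T t f g}"

text \<open>
  Only the values of \<open>f\<close> on \<open>cont_space T t\<close> enter here. Mathematically the value at a path
  in \<open>cont_space T t\<close>, for \<open>t < T\<close>, does not depend on which extension is chosen.
\<close>

definition vertical_deriv_cont ::
    "real \<Rightarrow> real \<Rightarrow> ('n::finite path \<Rightarrow> real) \<Rightarrow> 'n path \<Rightarrow> real^'n" where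
  "vertical_deriv_cont T t f = vertical_deriv (SOME g. C1_extension T t f g)"

definition S_fun :: "real \<Rightarrow> (real \<Rightarrow> real^'n) \<Rightarrow> (real \<Rightarrow> real^'n) \<Rightarrow> real" where
  "S_fun t \<gamma> \<gamma>' = (let N = sup_norm t (\<lambda>s. \<gamma> s - \<gamma>' s) in
     if N \<noteq> 0 then (N\<^sup>2 - (norm (\<gamma> t - \<gamma>' t))\<^sup>2)\<^sup>2 / N\<^sup>2 else 0)"

definition S_from :: "real \<Rightarrow> (real \<Rightarrow> real^'n) \<Rightarrow> 'n path \<Rightarrow> real" where
  "S_from t0 a = (\<lambda>(t, \<gamma>). S_fun t \<gamma> (extend t0 a t))"

definition g_from :: "real \<Rightarrow> (real \<Rightarrow> real^'n) \<Rightarrow> 'n path \<Rightarrow> real" where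
  "g_from t0 a = (\<lambda>(t, \<gamma>). LBINT s:{0..t}. (norm (\<gamma> s - extend t0 a t s))\<^sup>2)"

definition abs_continuous_on :: "real \<Rightarrow> real \<Rightarrow> (real \<Rightarrow> real^'n) \<Rightarrow> bool" where
  "abs_continuous_on u v X \<longleftrightarrow> (\<forall>\<epsilon>>0. \<exists>\<delta>>0. \<forall>\<D> A.
     \<D> division_of A \<and> A \<subseteq> {u..v} \<and> (\<Sum>K\<in>\<D>. Sup K - Inf K) < \<delta> \<longrightarrow>
     (\<Sum>K\<in>\<D>. norm (X (Sup K) - X (Inf K))) < \<epsilon>)"

text \<open>
  The integral of a row vector \<open>F\<close> against \<open>dX\<close> in the Riemann--Stieltjes sense (mesh limit).
  For continuous \<open>F\<close> and absolutely continuous \<open>X\<close> it agrees with the Lebesgue--Stieltjes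
  integral and with the Lebesgue integral of \<open>F \<bullet> X'\<close>.
\<close>

definition has_stieltjes_integral ::
    "(real \<Rightarrow> real^'n) \<Rightarrow> (real \<Rightarrow> real^'n) \<Rightarrow> real \<Rightarrow> real \<Rightarrow> real \<Rightarrow> bool" where
  "has_stieltjes_integral F X u v I \<longleftrightarrow> (\<forall>\<epsilon>>0. \<exists>\<delta>>0. \<forall>P.
     P tagged_division_of {u..v} \<and> (\<forall>(\<xi>, K)\<in>P. Sup K - Inf K < \<delta>) \<longrightarrow>
     \<bar>(\<Sum>(\<xi>, K)\<in>P. F \<xi> \<bullet> (X (Sup K) - X (Inf K))) - I\<bar> < \<epsilon>)"

definition stieltjes_integrable ::
    "(real \<Rightarrow> real^'n) \<Rightarrow> (real \<Rightarrow> real^'n) \<Rightarrow> real \<Rightarrow> real \<Rightarrow> bool" where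
  "stieltjes_integrable F X u v \<longleftrightarrow> (\<exists>I. has_stieltjes_integral F X u v I)"

definition stieltjes_integral ::
    "(real \<Rightarrow> real^'n) \<Rightarrow> (real \<Rightarrow> real^'n) \<Rightarrow> real \<Rightarrow> real \<Rightarrow> real" where
  "stieltjes_integral F X u v = (THE I. has_stieltjes_integral F X u v I)"

definition path_upto :: "(real \<Rightarrow> real^'n) \<Rightarrow> real \<Rightarrow> 'n path" where
  "path_upto X s = (s, restrict X {0..s})"

end

theory Submission
  imports Defs
begin

text \<open>
  Write \<open>N\<close> for the sup distance \<open>\<parallel>\<gamma> - a\<parallel>\<^sub>0\<close> and \<open>y\<close> for the final
  difference \<open>\<gamma>(t) - a(t\<^sub>0)\<close>. Both are Lipschitz for the path distance, and
  \<open>S = (N\<^sup>2 - |y|\<^sup>2)\<^sup>2 / N\<^sup>2\<close>. A vertical bump only moves \<open>y\<close>: if \<open>M\<close> is the sup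
  distance over \<open>[0, t)\<close>, then \<open>N = max M |y|\<close> and \<open>S = (max 0 (M\<^sup>2 - |y|\<^sup>2))\<^sup>2 / M\<^sup>2\<close>, which is
  continuously differentiable in \<open>y\<close>; the horizontal derivative vanishes because \<open>N\<close> and \<open>y\<close> do not
  change along frozen paths. The Stieltjes formula holds because \<open>N\<close> can grow only while \<open>N = |y|\<close>,
  where \<open>S\<close> is flat to second order.

  The vertical derivative on continuous paths does not depend on the extension: if a \<open>C\<^sup>1\<close> functional
  \<open>h\<close> vanishes on continuous paths, approximate a short linear ramp by staircases, whose increments
  are horizontal and vertical increments of \<open>h\<close>; this gives \<open>\<partial>\<^sub>t h + \<partial>\<^sub>x\<^sub>i h = 0\<close>, while
  \<open>\<partial>\<^sub>t h = 0\<close> on frozen paths. The final time is reached by continuity.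
\<close>

section \<open>Cadlag paths and the path distance\<close>

text \<open>Regularity of \<open>S\<close> reduces to functions of the pair (\<open>dev\<close>,
  \<open>gap\<close>), which ranges over the cone |y| \<le> n. Their only singularity there is the
  apex, where they tend to 0; as division by zero yields 0, one formula also covers the degenerate
  case. On continuous paths the vertical derivative is defined through an unspecified extension, and
  a nonzero bump of a continuous path with positive final time is never continuous. So the
  derivative cannot be computed before independence of the extension is known. Horizontal
  derivatives are one-sided limits, hence the mean value inequality for right derivatives; a ramp
  along a basis vector makes elapsed time and displacement equal, hence the plain sum of the two
  derivatives. Along \<open>X\<close> the running maximum is monotone but need not be
  differentiable, so no chain rule applies to \<open>S\<close>. Instead every increment of
  \<open>S\<close> is compared with its linear part up to squares of increments of \<open>X\<close>;
  uniform continuity and bounded variation make the sum of these squares vanish with the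
  mesh.\<close>

lemma cadlag_left_limit:
  assumes "\<gamma> \<in> cadlag_paths t" "0 < s" "s \<le> t"
  obtains l where "(\<gamma> \<longlongrightarrow> l) (at_left s)"
proof -
  have "\<forall>s\<in>{0<..t}. \<exists>l. (\<gamma> \<longlongrightarrow> l) (at_left s)" using assms(1) by (simp add: cadlag_paths_def)
  with assms(2,3) have "\<exists>l. (\<gamma> \<longlongrightarrow> l) (at_left s)" by simp
  with that show thesis by metis
qed

text \<open>One-sided limits bound the path on either side of each point, and compactness reduces
  these local bounds to finitely many.\<close>

lemma cadlag_bounded:
  assumes g: "\<gamma> \<in> cadlag_paths t"
  obtains B where "\<And>u. u \<in> {0..t} \<Longrightarrow> norm (\<gamma> u) \<le> B"
proof -
  have near: "\<exists>e>0. \<exists>B. \<forall>x\<in>{0..t}. \<bar>x - s\<bar> < e \<longrightarrow> norm (\<gamma> x) \<le> B" if s: "s \<in> {0..t}" for s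
  proof -
    \<comment> \<open>The guard \<open>x \<le> t\<close> makes the claim vacuous at the right
      endpoint, where no right limit is given.\<close>
    have "\<exists>b>s. \<exists>B. \<forall>x>s. x < b \<longrightarrow> x \<le> t \<longrightarrow> norm (\<gamma> x) \<le> B"
    proof (cases "s < t")
      case True
      then have "(\<gamma> \<longlongrightarrow> \<gamma> s) (at_right s)" using g s by (auto simp: cadlag_paths_def)
      then have "\<forall>\<^sub>F x in at_right s. dist (\<gamma> x) (\<gamma> s) < 1" by (rule tendstoD) simp
      then obtain b where "b > s" "\<And>x. x > s \<Longrightarrow> x < b \<Longrightarrow> dist (\<gamma> x) (\<gamma> s) < 1"
        unfolding eventually_at_right_field by blast
      moreover have "norm (\<gamma> x) \<le> norm (\<gamma> s) + 1" if "dist (\<gamma> x) (\<gamma> s) < 1" for x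
        using that norm_triangle_sub[of "\<gamma> x" "\<gamma> s"] by (simp add: dist_norm)
      ultimately show ?thesis by blast
    qed (intro exI[of _ "s+1"], auto)
    then obtain b B where b: "b > s" "\<And>x. x > s \<Longrightarrow> x < b \<Longrightarrow> x \<le> t \<Longrightarrow> norm (\<gamma> x) \<le> B" by blast
    have "\<exists>c<s. \<exists>B. \<forall>x>c. x < s \<longrightarrow> 0 \<le> x \<longrightarrow> norm (\<gamma> x) \<le> B"
    proof (cases "0 < s")
      case True
      obtain l where "(\<gamma> \<longlongrightarrow> l) (at_left s)" by (rule cadlag_left_limit[OF g, of s]) (use s True in auto)
      then have "\<forall>\<^sub>F x in at_left s. dist (\<gamma> x) l < 1" by (rule tendstoD) simp
      then obtain c where "c < s" "\<And>x. x > c \<Longrightarrow> x < s \<Longrightarrow> dist (\<gamma> x) l < 1"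
        unfolding eventually_at_left_field by blast
      moreover have "norm (\<gamma> x) \<le> norm l + 1" if "dist (\<gamma> x) l < 1" for x
        using that norm_triangle_sub[of "\<gamma> x" l] by (simp add: dist_norm)
      ultimately show ?thesis by blast
    qed (intro exI[of _ "s-1"], auto)
    then obtain c C where c: "c < s" "\<And>x. x > c \<Longrightarrow> x < s \<Longrightarrow> 0 \<le> x \<Longrightarrow> norm (\<gamma> x) \<le> C" by blast
    have "norm (\<gamma> x) \<le> max (norm (\<gamma> s)) (max B C)"
      if "x \<in> {0..t}" "\<bar>x - s\<bar> < min (b - s) (s - c)" for x
      using b(2)[of x] c(2)[of x] that by (cases x s rule: linorder_cases) auto
    with b(1) c(1) show ?thesis
      by (intro exI[of _ "min (b - s) (s - c)"] conjI exI[of _ "max (norm (\<gamma> s)) (max B C)"]) auto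
  qed
  then obtain e where e: "\<And>s. s \<in> {0..t} \<Longrightarrow> e s > 0"
    "\<And>s. s \<in> {0..t} \<Longrightarrow> \<exists>B. \<forall>x\<in>{0..t}. \<bar>x - s\<bar> < e s \<longrightarrow> norm (\<gamma> x) \<le> B" by metis
  then obtain B where B: "\<And>s x. s \<in> {0..t} \<Longrightarrow> x \<in> {0..t} \<Longrightarrow> \<bar>x - s\<bar> < e s \<Longrightarrow> norm (\<gamma> x) \<le> B s"
    by metis
  have "compact {0..t}" by simp
  moreover have "{0..t} \<subseteq> (\<Union>s\<in>{0..t}. ball s (e s))" using e(1) by auto
  ultimately obtain C where C: "C \<subseteq> {0..t}" "finite C" "{0..t} \<subseteq> (\<Union>s\<in>C. ball s (e s))"
    by (elim compactE_image) auto
  show thesis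
  proof
    fix u assume u: "u \<in> {0..t}"
    then obtain s where s: "s \<in> C" "\<bar>u - s\<bar> < e s" using C(3) by (auto simp: dist_real_def)
    then have "norm (\<gamma> u) \<le> \<bar>B s\<bar>" using B[of s u] C(1) u by fastforce
    also have "\<dots> \<le> (\<Sum>s\<in>C. \<bar>B s\<bar>)" using C s by (intro member_le_sum) auto
    finally show "norm (\<gamma> u) \<le> (\<Sum>s\<in>C. \<bar>B s\<bar>)" .
  qed
qed

text \<open>Rounding the argument up to the grid of mesh \<open>1 / Suc n\<close> gives functions
  that factor through the integers, hence are measurable, and converge pointwise by right
  continuity.\<close>

lemma borel_measurable_right_continuous:
  fixes f :: "real \<Rightarrow> 'a::metric_space"
  assumes "\<And>x. (f \<longlongrightarrow> f x) (at_right x)"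
  shows "f \<in> borel_measurable borel"
proof (rule borel_measurable_LIMSEQ_metric)
  fix n :: nat
  have "(\<lambda>k::int. f ((of_int k + 1) / real (Suc n))) \<in> measurable (count_space UNIV) borel" by simp
  from measurable_compose[OF _ this, of "\<lambda>x. \<lfloor>real (Suc n) * x\<rfloor>" borel]
  show "(\<lambda>x. f ((of_int \<lfloor>real (Suc n) * x\<rfloor> + 1) / real (Suc n))) \<in> borel_measurable borel"
    by (simp del: of_nat_Suc)
next
  fix x :: real
  let ?r = "\<lambda>n. (of_int \<lfloor>real (Suc n) * x\<rfloor> + 1) / real (Suc n)"
  \<comment> \<open>The \<open>+ 1\<close> after the floor keeps the grid point strictly to the
    right even when \<open>x\<close> lies on the grid, as convergence along
    \<open>at_right x\<close> demands.\<close>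
  have gt: "?r n > x" for n
    by (simp add: pos_less_divide_eq mult.commute del: of_nat_Suc) 
  have le: "?r n \<le> x + 1 / real (Suc n)" for n
    by (simp add: field_simps del: of_nat_Suc)
  have "(\<lambda>n. x + 1 / real (Suc n)) \<longlonglongrightarrow> x + 0"
    by (intro tendsto_intros LIMSEQ_Suc lim_1_over_n) 
  then have "?r \<longlonglongrightarrow> x"
    using gt le by (intro tendsto_sandwich[of "\<lambda>_. x" ?r sequentially "\<lambda>n. x + 1 / real (Suc n)"])
      (auto intro!: always_eventually less_imp_le simp del: of_nat_Suc)
  then have "filterlim ?r (at_right x) sequentially"
    using gt less_imp_neq[OF gt, symmetric] by (auto simp: filterlim_at simp del: of_nat_Suc)
  then show "(\<lambda>n. f (?r n)) \<longlonglongrightarrow> f x"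
    by (rule filterlim_compose[OF assms])
qed

text \<open>Clamping the argument extends the path by constants to the whole line, so that right
  continuity holds everywhere, including at \<open>t\<close>.\<close>

lemma cadlag_measurable:
  assumes g: "\<gamma> \<in> cadlag_paths t" and t: "0 \<le> t"
  shows "(\<lambda>u. \<gamma> (max 0 (min u t))) \<in> borel_measurable borel"
proof (rule borel_measurable_right_continuous)
  fix x
  consider "x < 0" | "0 \<le> x" "x < t" | "t \<le> x" by linarith
  then show "((\<lambda>u. \<gamma> (max 0 (min u t))) \<longlongrightarrow> \<gamma> (max 0 (min x t))) (at_right x)"
  proof cases
    case 1
    have "\<forall>\<^sub>F u in at_right x. \<gamma> (max 0 (min u t)) = \<gamma> 0"
      unfolding eventually_at_right_field using 1 t by (intro exI[of _ 0]) auto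
    with 1 t show ?thesis by (simp add: tendsto_eventually)
  next
    case 2
    then have "(\<gamma> \<longlongrightarrow> \<gamma> x) (at_right x)" using g by (auto simp: cadlag_paths_def)
    moreover have "\<forall>\<^sub>F u in at_right x. \<gamma> u = \<gamma> (max 0 (min u t))"
      unfolding eventually_at_right_field using 2 by (intro exI[of _ t]) auto
    ultimately show ?thesis using 2 by (auto elim: Lim_transform_eventually)
  next
    case 3
    have "\<forall>\<^sub>F u in at_right x. \<gamma> (max 0 (min u t)) = \<gamma> t"
      unfolding eventually_at_right_field using 3 t by (intro exI[of _ "x+1"]) auto
    with 3 t show ?thesis by (simp add: tendsto_eventually)
  qed
qed

lemma cont_imp_cadlag:
  assumes "\<gamma> \<in> cont_paths t" shows "\<gamma> \<in> cadlag_paths t"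
proof -
  have lim: "(\<gamma> \<longlongrightarrow> \<gamma> s) (at s within {0..t})" if "s \<in> {0..t}" for s
    using assms that by (auto simp: cont_paths_def continuous_on)
  have "(\<gamma> \<longlongrightarrow> \<gamma> s) (at_right s)" if "s \<in> {0..<t}" for s
    using tendsto_within_subset[OF lim[of s], of "{s..t}"] that
    by (auto simp: at_within_Icc_at_right)
  moreover have "(\<gamma> \<longlongrightarrow> \<gamma> s) (at_left s)" if "s \<in> {0<..t}" for s
    using tendsto_within_subset[OF lim[of s], of "{0..s}"] that
    by (auto simp: at_within_Icc_at_left)
  moreover have "\<gamma> \<in> extensional {0..t}" using assms by (simp add: cont_paths_def)
  ultimately show ?thesis unfolding cadlag_paths_def by (intro CollectI conjI ballI exI)
qed

lemma cont_space_subset: "cont_space T t \<subseteq> cadlag_space T t"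
  by (auto simp: cont_space_def cadlag_space_def cont_imp_cadlag)

lemma extend_cadlag:
  assumes g: "\<gamma> \<in> cadlag_paths t" and t: "0 \<le> t" "t \<le> u"
  shows "extend t \<gamma> u \<in> cadlag_paths u"
proof -
  let ?e = "extend t \<gamma> u"
  have "(?e \<longlongrightarrow> ?e s) (at_right s)" if s: "s \<in> {0..<u}" for s
  proof (cases "s < t")
    case True
    then have "(\<gamma> \<longlongrightarrow> \<gamma> s) (at_right s)" using g s by (auto simp: cadlag_paths_def)
    moreover have "\<forall>\<^sub>F x in at_right s. \<gamma> x = ?e x"
      unfolding eventually_at_right_field using True s t
      by (intro exI[of _ t]) (auto simp: extend_def)
    moreover have "?e s = \<gamma> s" using True s by (auto simp: extend_def)
    ultimately show ?thesis by (auto elim: Lim_transform_eventually)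
  next
    case False
    have "\<forall>\<^sub>F x in at_right s. ?e x = ?e s"
      unfolding eventually_at_right_field using False s t
      by (intro exI[of _ u]) (auto simp: extend_def)
    then show ?thesis by (rule tendsto_eventually)
  qed
  moreover have "\<exists>l. (?e \<longlongrightarrow> l) (at_left s)" if s: "s \<in> {0<..u}" for s
  proof (cases "s \<le> t")
    case True
    obtain l where "(\<gamma> \<longlongrightarrow> l) (at_left s)" by (rule cadlag_left_limit[OF g, of s]) (use s True in auto)
    moreover have "\<forall>\<^sub>F x in at_left s. \<gamma> x = ?e x"
      unfolding eventually_at_left_field using True s t
      by (intro exI[of _ 0]) (auto simp: extend_def)
    ultimately show ?thesis by (auto elim: Lim_transform_eventually)
  next
    case False
    have "\<forall>\<^sub>F x in at_left s. ?e x = \<gamma> t"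
      unfolding eventually_at_left_field using False s t
      by (intro exI[of _ t]) (auto simp: extend_def)
    then show ?thesis by (metis tendsto_eventually)
  qed
  ultimately show ?thesis by (auto simp: cadlag_paths_def extend_def)
qed

lemma bump_cadlag:
  assumes g: "\<gamma> \<in> cadlag_paths t" and t: "0 \<le> t"
  shows "bump t \<gamma> x \<in> cadlag_paths t"
proof -
  let ?b = "bump t \<gamma> x"
  have "(?b \<longlongrightarrow> ?b s) (at_right s)" if s: "s \<in> {0..<t}" for s
  proof -
    have "(\<gamma> \<longlongrightarrow> \<gamma> s) (at_right s)" using g s by (auto simp: cadlag_paths_def)
    moreover have "\<forall>\<^sub>F x in at_right s. \<gamma> x = ?b x"
      unfolding eventually_at_right_field using s
      by (intro exI[of _ t]) (auto simp: bump_def)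
    ultimately show ?thesis using s by (auto simp: bump_def elim: Lim_transform_eventually)
  qed
  moreover have "\<exists>l. (?b \<longlongrightarrow> l) (at_left s)" if s: "s \<in> {0<..t}" for s
  proof -
    obtain l where "(\<gamma> \<longlongrightarrow> l) (at_left s)" by (rule cadlag_left_limit[OF g, of s]) (use s in auto)
    moreover have "\<forall>\<^sub>F x in at_left s. \<gamma> x = ?b x"
      unfolding eventually_at_left_field using s
      by (intro exI[of _ 0]) (auto simp: bump_def)
    ultimately show ?thesis by (auto elim: Lim_transform_eventually)
  qed
  ultimately show ?thesis using g t by (auto simp: cadlag_paths_def bump_def extensional_def)
qed

lemma restrict_cadlag:
  assumes g: "\<gamma> \<in> cadlag_paths t" and r: "r \<le> t"
  shows "restrict \<gamma> {0..r} \<in> cadlag_paths r"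
proof -
  let ?b = "restrict \<gamma> {0..r}"
  have "(?b \<longlongrightarrow> ?b s) (at_right s)" if s: "s \<in> {0..<r}" for s
  proof -
    have "(\<gamma> \<longlongrightarrow> \<gamma> s) (at_right s)" using g s r by (auto simp: cadlag_paths_def)
    moreover have "\<forall>\<^sub>F x in at_right s. \<gamma> x = ?b x"
      unfolding eventually_at_right_field using s
      by (intro exI[of _ r]) auto
    ultimately show ?thesis using s by (auto elim: Lim_transform_eventually)
  qed
  moreover have "\<exists>l. (?b \<longlongrightarrow> l) (at_left s)" if s: "s \<in> {0<..r}" for s
  proof -
    obtain l where "(\<gamma> \<longlongrightarrow> l) (at_left s)" by (rule cadlag_left_limit[OF g, of s]) (use s r in auto)
    moreover have "\<forall>\<^sub>F x in at_left s. \<gamma> x = ?b x"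
      unfolding eventually_at_left_field using s
      by (intro exI[of _ 0]) auto
    ultimately show ?thesis by (blast intro: Lim_transform_eventually)
  qed
  ultimately show ?thesis by (auto simp: cadlag_paths_def)
qed

lemma extend_apply: "0 \<le> u \<Longrightarrow> u \<le> r \<Longrightarrow> extend t \<gamma> r u = \<gamma> (min u t)"
  by (auto simp: extend_def min_def)

text \<open>A real \<open>SUP\<close> dominates its terms only when they are bounded above; this
  supplies the bound for every supremum of path differences.\<close>

lemma cadlag_diff_bdd_above:
  assumes g: "\<gamma> \<in> cadlag_paths s" and e: "\<eta> \<in> cadlag_paths s'" and s: "0 \<le> s" "0 \<le> s'"
  shows "bdd_above ((\<lambda>u. norm (\<gamma> (min u s) - \<eta> (min u s'))) ` {0..})"
proof -
  obtain B where "\<And>u. u \<in> {0..s} \<Longrightarrow> norm (\<gamma> u) \<le> B" using cadlag_bounded[OF g] by metis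
  moreover obtain C where "\<And>u. u \<in> {0..s'} \<Longrightarrow> norm (\<eta> u) \<le> C" using cadlag_bounded[OF e] by metis
  ultimately have "norm (\<gamma> (min u s) - \<eta> (min u s')) \<le> B + C" if "0 \<le> u" for u
    using that s norm_triangle_ineq4[of "\<gamma> (min u s)" "\<eta> (min u s')"]
    by (intro order_trans[OF norm_triangle_ineq4] add_mono) auto
  then show ?thesis by (intro bdd_aboveI2) auto
qed

lemma d_infty_altdef:
  assumes "0 \<le> s" "0 \<le> s'"
  shows "d_infty (s, \<gamma>) (s', \<eta>) =
    \<bar>s - s'\<bar> + (SUP u\<in>{0..max s s'}. norm (\<gamma> (min u s) - \<eta> (min u s')))"
  unfolding d_infty_def sup_norm_def by (auto simp: extend_apply cong: SUP_cong_simp)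

lemma d_infty_ge:
  assumes g: "\<gamma> \<in> cadlag_paths s" and e: "\<eta> \<in> cadlag_paths s'" and s: "0 \<le> s" "0 \<le> s'" and u: "0 \<le> u"
  shows "\<bar>s - s'\<bar> + norm (\<gamma> (min u s) - \<eta> (min u s')) \<le> d_infty (s, \<gamma>) (s', \<eta>)"
proof -
  let ?f = "\<lambda>u. norm (\<gamma> (min u s) - \<eta> (min u s'))"
  have "?f u = ?f (min u (max s s'))" by (simp add: min.assoc)
  also have "\<dots> \<le> (SUP u\<in>{0..max s s'}. ?f u)"
    using u s bdd_above_mono[OF cadlag_diff_bdd_above[OF g e s] image_mono, of "{0..max s s'}"]
    by (intro cSUP_upper) auto
  finally show ?thesis using s by (simp add: d_infty_altdef)
qed

lemma d_infty_le:
  assumes "0 \<le> s" "0 \<le> s'"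
    and "\<And>u. 0 \<le> u \<Longrightarrow> u \<le> max s s' \<Longrightarrow> norm (\<gamma> (min u s) - \<eta> (min u s')) \<le> c"
  shows "d_infty (s, \<gamma>) (s', \<eta>) \<le> \<bar>s - s'\<bar> + c"
  unfolding d_infty_altdef[OF assms(1,2)] using assms by (intro add_left_mono cSUP_least) auto

section \<open>Continuity of functionals\<close>

lemma cadlag_spaceI: "t \<le> s \<Longrightarrow> s \<le> T \<Longrightarrow> \<gamma> \<in> cadlag_paths s \<Longrightarrow> (s, \<gamma>) \<in> cadlag_space T t"
  by (simp add: cadlag_space_def)

text \<open>Reduces continuity of a functional to continuity of an ordinary function of a Lipschitz
  statistic. Restricting to a set \<open>D\<close> containing the range is what admits quotients
  that are singular elsewhere.\<close>

lemma C0_cadlag_compose: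
  fixes m :: "'n::finite path \<Rightarrow> 'm::metric_space" and F :: "'m \<Rightarrow> real"
  assumes lip: "\<And>p q. p \<in> cadlag_space T t \<Longrightarrow> q \<in> cadlag_space T t \<Longrightarrow> dist (m p) (m q) \<le> K * d_infty p q"
    and K: "K > 0" and F: "continuous_on D F" and D: "m ` cadlag_space T t \<subseteq> D"
  shows "(\<lambda>p. F (m p)) \<in> C0_cadlag T t"
  unfolding C0_cadlag_def
proof safe
  fix s and \<gamma> :: "real \<Rightarrow> real^'n" and \<epsilon> :: real assume p: "(s, \<gamma>) \<in> cadlag_space T t" and "\<epsilon> > 0"
  then obtain d where d: "d > 0" "\<And>y. y \<in> D \<Longrightarrow> dist y (m (s, \<gamma>)) < d \<Longrightarrow> dist (F y) (F (m (s, \<gamma>))) < \<epsilon>"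
    using F D unfolding continuous_on_iff by (metis image_subset_iff)
  have "\<bar>F (m q) - F (m (s, \<gamma>))\<bar> < \<epsilon>" if q: "q \<in> cadlag_space T t" "d_infty (s, \<gamma>) q < d / K" for q
  proof -
    have "dist (m (s, \<gamma>)) (m q) < d" using lip[OF p q(1)] q(2) K by (simp add: field_simps)
    with d(2)[of "m q"] q(1) D show ?thesis by (auto simp: dist_real_def dist_commute)
  qed
  with d(1) K show "\<exists>\<delta>>0. \<forall>q\<in>cadlag_space T t. d_infty (s, \<gamma>) q < \<delta> \<longrightarrow> \<bar>F (m q) - F (m (s, \<gamma>))\<bar> < \<epsilon>"
    by (intro exI[of _ "d / K"]) auto
qed

lemma C0_cadlagE:
  assumes "f \<in> C0_cadlag T t" "p \<in> cadlag_space T t" "0 < \<epsilon>"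
  obtains \<delta> where "\<delta> > 0" "\<And>q. q \<in> cadlag_space T t \<Longrightarrow> d_infty p q < \<delta> \<Longrightarrow> \<bar>f q - f p\<bar> < \<epsilon>"
proof -
  have "\<exists>\<delta>>0. \<forall>q\<in>cadlag_space T t. d_infty p q < \<delta> \<longrightarrow> \<bar>f q - f p\<bar> < \<epsilon>"
    using assms unfolding C0_cadlag_def by simp
  with that show thesis by metis
qed

lemma C0_cadlag_cong:
  assumes "f \<in> C0_cadlag T t" "\<And>p. p \<in> cadlag_space T t \<Longrightarrow> f p = g p"
  shows "g \<in> C0_cadlag T t"
  using assms unfolding C0_cadlag_def by simp

lemma C0_cadlag_diff:
  fixes f g :: "'n::finite path \<Rightarrow> real"
  assumes f: "f \<in> C0_cadlag T t" and g: "g \<in> C0_cadlag T t"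
  shows "(\<lambda>p. f p - g p) \<in> C0_cadlag T t"
  unfolding C0_cadlag_def mem_Collect_eq
proof (intro ballI allI impI)
  fix p :: "'n path" and \<epsilon> :: real assume p: "p \<in> cadlag_space T t" and "\<epsilon> > 0"
  then have "\<epsilon> / 2 > 0" by simp
  then obtain d e where de: "d > 0" "\<And>q. q \<in> cadlag_space T t \<Longrightarrow> d_infty p q < d \<Longrightarrow> \<bar>f q - f p\<bar> < \<epsilon> / 2"
    "e > 0" "\<And>q. q \<in> cadlag_space T t \<Longrightarrow> d_infty p q < e \<Longrightarrow> \<bar>g q - g p\<bar> < \<epsilon> / 2"
    using f g p unfolding C0_cadlag_def mem_Collect_eq by metis
  have "\<bar>f q - g q - (f p - g p)\<bar> < \<epsilon>" if "q \<in> cadlag_space T t" "d_infty p q < min d e" for q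
    using de(2)[of q] de(4)[of q] that by (auto simp: abs_if split: if_splits)
  with de(1,3) show "\<exists>\<delta>>0. \<forall>q\<in>cadlag_space T t. d_infty p q < \<delta> \<longrightarrow> \<bar>f q - g q - (f p - g p)\<bar> < \<epsilon>"
    by (intro exI[of _ "min d e"]) auto
qed

section \<open>Sup distance and final difference to a frozen reference path\<close>

definition dev :: "real \<Rightarrow> (real \<Rightarrow> real^'n) \<Rightarrow> 'n::finite path \<Rightarrow> real" where
  "dev t0 a = (\<lambda>(s, \<gamma>). sup_norm s (\<lambda>u. \<gamma> u - extend t0 a s u))"

text \<open>\<open>dev\<close> and \<open>gap\<close> are the \<open>N\<close> and \<open>y\<close>
  of the overview. The value \<open>a t0\<close> is the right reference at any final time
  \<open>s \<ge> t0\<close>, since the reference path is frozen after \<open>t0\<close>.\<close>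

definition gap :: "real \<Rightarrow> (real \<Rightarrow> real^'n) \<Rightarrow> 'n::finite path \<Rightarrow> real^'n" where
  "gap t0 a = (\<lambda>(s, \<gamma>). \<gamma> s - a t0)"

lemma gap_extend: "0 \<le> s \<Longrightarrow> s \<le> r \<Longrightarrow> gap t0 a (r, extend s \<gamma> r) = gap t0 a (s, \<gamma>)"
  by (simp add: gap_def extend_apply)

context
  fixes T t0 :: real and a :: "real \<Rightarrow> real^'n"
  assumes t0: "0 \<le> t0" and a: "a \<in> cadlag_paths t0"
begin

lemma dev_upper:
  assumes g: "\<gamma> \<in> cadlag_paths s" and s: "t0 \<le> s" and u: "0 \<le> u"
  shows "norm (\<gamma> (min u s) - a (min u t0)) \<le> dev t0 a (s, \<gamma>)"
proof -
  have "min (min u s) t0 = min u t0" using s by simp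
  then have "norm (\<gamma> (min u s) - a (min u t0)) = norm (\<gamma> (min u s) - extend t0 a s (min u s))"
    using s u t0 by (simp add: extend_apply)
  also have "\<dots> \<le> (SUP v\<in>{0..s}. norm (\<gamma> v - extend t0 a s v))"
  proof (rule cSUP_upper)
    have "(\<lambda>v. norm (\<gamma> v - extend t0 a s v)) ` {0..s} \<subseteq> (\<lambda>u. norm (\<gamma> (min u s) - a (min u t0))) ` {0..}"
    proof (rule image_subsetI)
      fix v assume "v \<in> {0..s}"
      then show "norm (\<gamma> v - extend t0 a s v) \<in> (\<lambda>u. norm (\<gamma> (min u s) - a (min u t0))) ` {0..}"
        by (intro image_eqI[of _ _ v]) (auto simp: extend_apply)
    qed
    moreover have "bdd_above ((\<lambda>u. norm (\<gamma> (min u s) - a (min u t0))) ` {0..})"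
      using s t0 by (intro cadlag_diff_bdd_above[OF g a]) auto
    ultimately show "bdd_above ((\<lambda>v. norm (\<gamma> v - extend t0 a s v)) ` {0..s})"
      by (meson bdd_above_mono)
  qed (use u s t0 in auto)
  finally show ?thesis by (simp add: dev_def sup_norm_def)
qed

lemma dev_least:
  assumes "0 \<le> s" "\<And>u. 0 \<le> u \<Longrightarrow> u \<le> s \<Longrightarrow> norm (\<gamma> u - a (min u t0)) \<le> c"
  shows "dev t0 a (s, \<gamma>) \<le> c"
  unfolding dev_def sup_norm_def prod.case using assms by (intro cSUP_least) (auto simp: extend_apply)

lemma gap_le_dev:
  assumes "\<gamma> \<in> cadlag_paths s" "t0 \<le> s"
  shows "norm (gap t0 a (s, \<gamma>)) \<le> dev t0 a (s, \<gamma>)"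
  using dev_upper[OF assms, of s] assms t0 by (simp add: gap_def)

text \<open>At each common time the reference value cancels from the difference, so the two suprema
  differ by no more than the path distance.\<close>

lemma dev_lipschitz:
  assumes p: "p \<in> cadlag_space T t0" and q: "q \<in> cadlag_space T t0"
  shows "\<bar>dev t0 a p - dev t0 a q\<bar> \<le> d_infty p q"
proof -
  obtain s \<gamma> r \<eta> where pq: "p = (s, \<gamma>)" "q = (r, \<eta>)" by (cases p, cases q)
  have g: "\<gamma> \<in> cadlag_paths s" "t0 \<le> s" and e: "\<eta> \<in> cadlag_paths r" "t0 \<le> r"
    using p q by (auto simp: pq cadlag_space_def)
  have d: "norm (\<gamma> (min u s) - \<eta> (min u r)) \<le> d_infty p q" if "0 \<le> u" for u
    using d_infty_ge[OF g(1) e(1) _ _ that] g e t0 unfolding pq by (smt (verit))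
  have "dev t0 a (s, \<gamma>) \<le> dev t0 a q + d_infty p q"
  proof (rule dev_least)
    fix u assume u: "0 \<le> u" "u \<le> s"
    then have "\<gamma> u - a (min u t0) = (\<eta> (min u r) - a (min u t0)) + (\<gamma> (min u s) - \<eta> (min u r))" by simp
    also have "norm \<dots> \<le> dev t0 a q + d_infty p q"
      by (intro norm_triangle_mono d u) (use dev_upper[OF e u(1)] in \<open>simp add: pq\<close>)
    finally show "norm (\<gamma> u - a (min u t0)) \<le> dev t0 a q + d_infty p q" .
  qed (use g t0 in auto)
  moreover have "dev t0 a (r, \<eta>) \<le> dev t0 a p + d_infty p q"
  proof (rule dev_least)
    fix u assume u: "0 \<le> u" "u \<le> r"
    then have "\<eta> u - a (min u t0) = (\<gamma> (min u s) - a (min u t0)) - (\<gamma> (min u s) - \<eta> (min u r))" by simp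
    also have "norm \<dots> \<le> dev t0 a p + d_infty p q"
      by (rule order_trans[OF norm_triangle_ineq4], intro add_mono d u) (use dev_upper[OF g u(1)] in \<open>simp add: pq\<close>)
    finally show "norm (\<eta> u - a (min u t0)) \<le> dev t0 a p + d_infty p q" .
  qed (use e t0 in auto)
  ultimately show ?thesis unfolding pq by linarith
qed

lemma time_gap_lipschitz:
  assumes p: "p \<in> cadlag_space T t0" and q: "q \<in> cadlag_space T t0"
  shows "\<bar>fst p - fst q\<bar> + norm (gap t0 a p - gap t0 a q) \<le> d_infty p q"
proof -
  obtain s \<gamma> r \<eta> where pq: "p = (s, \<gamma>)" "q = (r, \<eta>)" by (cases p, cases q)
  have g: "\<gamma> \<in> cadlag_paths s" "t0 \<le> s" and e: "\<eta> \<in> cadlag_paths r" "t0 \<le> r"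
    using p q by (auto simp: pq cadlag_space_def)
  show ?thesis
    \<comment> \<open>At time \<open>max s r\<close> both clamped arguments are the final
      times.\<close>
    using d_infty_ge[OF g(1) e(1), of "max s r"] g e t0 by (simp add: pq gap_def)
qed

lemma dev_gap_lipschitz:
  assumes p: "p \<in> cadlag_space T t0" and q: "q \<in> cadlag_space T t0"
  shows "dist (dev t0 a p, gap t0 a p) (dev t0 a q, gap t0 a q) \<le> 2 * d_infty p q"
proof -
  have "dist (dev t0 a p, gap t0 a p) (dev t0 a q, gap t0 a q)
     \<le> \<bar>dev t0 a p - dev t0 a q\<bar> + norm (gap t0 a p - gap t0 a q)"
    unfolding dist_Pair_Pair by (intro order_trans[OF sqrt_sum_squares_le_sum]) (auto simp: dist_norm)
  with dev_lipschitz[OF p q] time_gap_lipschitz[OF p q] show ?thesis by linarith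
qed

lemma dev_gap_range: "(\<lambda>p. (dev t0 a p, gap t0 a p)) ` cadlag_space T t0 \<subseteq> {x. norm (snd x) \<le> fst x}"
  by (auto simp: cadlag_space_def gap_le_dev)

lemma dev_extend:
  assumes g: "\<gamma> \<in> cadlag_paths s" and s: "t0 \<le> s" "s \<le> r"
  shows "dev t0 a (r, extend s \<gamma> r) = dev t0 a (s, \<gamma>)"
proof (rule antisym)
  show "dev t0 a (r, extend s \<gamma> r) \<le> dev t0 a (s, \<gamma>)"
    using dev_upper[OF g s(1)] s t0 by (intro dev_least) (auto simp: extend_apply)
  have e: "extend s \<gamma> r \<in> cadlag_paths r" using g s t0 by (intro extend_cadlag) auto
  show "dev t0 a (s, \<gamma>) \<le> dev t0 a (r, extend s \<gamma> r)"
  proof (rule dev_least)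
    fix u assume "0 \<le> u" "u \<le> s"
    then show "norm (\<gamma> u - a (min u t0)) \<le> dev t0 a (r, extend s \<gamma> r)"
      using dev_upper[OF e, of u] s t0 by (simp add: extend_apply)
  qed (use s t0 in auto)
qed

lemma dev_bump:
  assumes g: "\<gamma> \<in> cadlag_paths s" and s: "t0 \<le> s"
  obtains M where "0 \<le> M"
    "\<And>x. dev t0 a (s, bump s \<gamma> x) = max M (norm (gap t0 a (s, \<gamma>) + x))"
proof
  \<comment> \<open>The value 0 at \<open>u = s\<close> removes the final time from the supremum, so
    that \<open>?M\<close> is independent of the bump, and keeps the index set nonempty when
    \<open>s = 0\<close>.\<close>
  let ?f = "\<lambda>u. norm (if u = s then 0 else \<gamma> u - a (min u t0))"
  let ?M = "SUP u\<in>{0..s}. ?f u"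
  have s0: "0 \<le> s" using s t0 by simp
  have D0: "0 \<le> dev t0 a (s, \<eta>)" if "\<eta> \<in> cadlag_paths s" for \<eta>
    by (rule order_trans[OF norm_ge_zero gap_le_dev[OF that s]])
  have le: "?f u \<le> dev t0 a (s, bump s \<gamma> x)" if "0 \<le> u" "u \<le> s" for u x
    using dev_upper[OF bump_cadlag[OF g s0] s that(1), of x] D0[OF bump_cadlag[OF g s0], of x] that
    by (auto simp: bump_def)
  have bdd: "bdd_above (?f ` {0..s})"
    by (rule bdd_aboveI2[of _ _ "dev t0 a (s, bump s \<gamma> 0)"]) (use le in simp)
  show M0: "0 \<le> ?M" using cSUP_upper[OF _ bdd, of s] s0 by simp
  show "dev t0 a (s, bump s \<gamma> x) = max ?M (norm (gap t0 a (s, \<gamma>) + x))" for x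
  proof (rule antisym)
    show "dev t0 a (s, bump s \<gamma> x) \<le> max ?M (norm (gap t0 a (s, \<gamma>) + x))"
    proof (rule dev_least[OF s0])
      fix u assume u: "0 \<le> u" "u \<le> s"
      show "norm (bump s \<gamma> x u - a (min u t0)) \<le> max ?M (norm (gap t0 a (s, \<gamma>) + x))"
      proof (cases "u = s")
        case True
        with s show ?thesis by (simp add: bump_def gap_def algebra_simps)
      next
        case False
        with cSUP_upper[OF _ bdd, of u] u show ?thesis by (simp add: bump_def)
      qed
    qed
    have "?M \<le> dev t0 a (s, bump s \<gamma> x)" using le s0 by (intro cSUP_least) auto
    moreover have "norm (gap t0 a (s, \<gamma>) + x) \<le> dev t0 a (s, bump s \<gamma> x)"
      using gap_le_dev[OF bump_cadlag[OF g s0] s, of x] by (simp add: bump_def gap_def algebra_simps)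
    ultimately show "max ?M (norm (gap t0 a (s, \<gamma>) + x)) \<le> dev t0 a (s, bump s \<gamma> x)" by simp
  qed
qed

end

section \<open>Regularity of S\<close>

text \<open>Away from the apex continuity is assumed; at the apex the bound forces both the value
  and the limit to be 0. The bound \<open>4 * n + n\<^sup>2\<close> is a common majorant:
  \<open>S\<close> is at most the square term, its gradient components at most the linear
  one.\<close>

lemma continuous_on_cone:
  fixes F :: "real \<times> 'b::real_normed_vector \<Rightarrow> real"
  assumes cont: "\<And>n y. n \<noteq> 0 \<Longrightarrow> isCont F (n, y)"
    and bd: "\<And>n y. norm y \<le> n \<Longrightarrow> \<bar>F (n, y)\<bar> \<le> 4 * n + n\<^sup>2"
  shows "continuous_on {x. norm (snd x) \<le> fst x} F"
  unfolding continuous_on_eq_continuous_within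
proof
  fix x :: "real \<times> 'b" assume x: "x \<in> {x. norm (snd x) \<le> fst x}"
  show "continuous (at x within {x. norm (snd x) \<le> fst x}) F"
  proof (cases "fst x = 0")
    case False
    then show ?thesis using cont[of "fst x" "snd x"] by (simp add: continuous_at_imp_continuous_within)
  next
    case True
    with x have x0: "x = (0, 0)" by (simp add: prod_eq_iff)
    have "F x = 0" using bd[of 0 0] x0 by simp
    moreover have "(F \<longlongrightarrow> 0) (at x within {x. norm (snd x) \<le> fst x})"
    proof (rule Lim_null_comparison)
      show "\<forall>\<^sub>F z in at x within {x. norm (snd x) \<le> fst x}. norm (F z) \<le> 4 * fst z + (fst z)\<^sup>2"
        using bd[of "snd z" "fst z" for z] by (auto simp: eventually_at_filter)
      have "((\<lambda>z. 4 * fst z + (fst z)\<^sup>2) \<longlongrightarrow> 4 * fst x + (fst x)\<^sup>2) (at x within {x. norm (snd x) \<le> fst x})"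
        by (intro tendsto_intros)
      then show "((\<lambda>z. 4 * fst z + (fst z)\<^sup>2) \<longlongrightarrow> 0) (at x within {x. norm (snd x) \<le> fst x})"
        by (simp add: x0)
    qed
    ultimately show ?thesis by (simp add: continuous_within)
  qed
qed

lemma S_quotient_continuous:
  "continuous_on {x. norm (snd x) \<le> fst x}
     (\<lambda>x::real \<times> 'b::real_normed_vector. ((fst x)\<^sup>2 - (norm (snd x))\<^sup>2)\<^sup>2 / (fst x)\<^sup>2)"
proof (rule continuous_on_cone)
  fix n :: real and y :: 'b assume y: "norm y \<le> n"
  then have "0 \<le> n\<^sup>2 - (norm y)\<^sup>2" "n\<^sup>2 - (norm y)\<^sup>2 \<le> n\<^sup>2" by (auto intro: power_mono)
  then have "(n\<^sup>2 - (norm y)\<^sup>2)\<^sup>2 \<le> (n\<^sup>2)\<^sup>2" by (intro power_mono)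
  then have "(n\<^sup>2 - (norm y)\<^sup>2)\<^sup>2 / n\<^sup>2 \<le> (n\<^sup>2)\<^sup>2 / n\<^sup>2" by (rule divide_right_mono) simp
  also have "\<dots> = n\<^sup>2" by (simp add: power2_eq_square)
  finally show "\<bar>((fst (n, y))\<^sup>2 - (norm (snd (n, y)))\<^sup>2)\<^sup>2 / (fst (n, y))\<^sup>2\<bar> \<le> 4 * n + n\<^sup>2"
    using order_trans[OF norm_ge_zero y] by simp
qed (intro continuous_intros, simp)

lemma S_gradient_continuous:
  "continuous_on {x. norm (snd x) \<le> fst x}
     (\<lambda>x::real \<times> (real^'n). - (4 * ((fst x)\<^sup>2 - (norm (snd x))\<^sup>2) * (snd x $ i)) / (fst x)\<^sup>2)"
proof (rule continuous_on_cone)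
  fix n :: real and y :: "real^'n" assume y: "norm y \<le> n"
  then have d: "0 \<le> n\<^sup>2 - (norm y)\<^sup>2" "n\<^sup>2 - (norm y)\<^sup>2 \<le> n\<^sup>2" by (auto intro: power_mono)
  have "\<bar>y $ i\<bar> \<le> n" using component_le_norm_cart[of y i] y by simp
  then have "4 * (n\<^sup>2 - (norm y)\<^sup>2) * \<bar>y $ i\<bar> \<le> 4 * n\<^sup>2 * n"
    using d by (intro mult_mono) auto
  then have "4 * (n\<^sup>2 - (norm y)\<^sup>2) * \<bar>y $ i\<bar> / n\<^sup>2 \<le> 4 * n\<^sup>2 * n / n\<^sup>2" by (rule divide_right_mono) simp
  also have "\<dots> \<le> 4 * n + n\<^sup>2" by (simp add: power2_eq_square)
  finally show "\<bar>- (4 * ((fst (n, y))\<^sup>2 - (norm (snd (n, y)))\<^sup>2) * (snd (n, y) $ i)) / (fst (n, y))\<^sup>2\<bar>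
      \<le> 4 * n + n\<^sup>2"
    using d by (simp add: abs_mult)
qed (intro continuous_intros, simp)

text \<open>The gradient from the theorem; its zero value at \<open>dev = 0\<close> comes from
  division by zero.\<close>

definition S_grad :: "real \<Rightarrow> (real \<Rightarrow> real^'n) \<Rightarrow> 'n::finite path \<Rightarrow> real^'n" where
  "S_grad t0 a p = (- (4 * ((dev t0 a p)\<^sup>2 - (norm (gap t0 a p))\<^sup>2)) / (dev t0 a p)\<^sup>2) *\<^sub>R gap t0 a p"

lemma S_grad_nth: "S_grad t0 a p $ i =
    - (4 * ((dev t0 a p)\<^sup>2 - (norm (gap t0 a p))\<^sup>2) * (gap t0 a p $ i)) / (dev t0 a p)\<^sup>2"
  by (simp only: S_grad_def vector_scaleR_component real_scaleR_def times_divide_eq_left mult_minus_left)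

text \<open>Squaring removes the kink of \<open>max 0\<close>. This is why \<open>S\<close>, unlike
  the sup norm, stays differentiable where a bumped final value takes over the maximum.\<close>

lemma has_real_derivative_max0_sq:
  "((\<lambda>t::real. (max 0 t)\<^sup>2) has_real_derivative 2 * max 0 t) (at t)"
proof -
  consider "t < 0" | "t = 0" | "t > 0" by linarith
  then show ?thesis
  proof cases
    case 1
    have "((\<lambda>t::real. 0) has_real_derivative 0) (at t)" by simp
    moreover have "\<forall>\<^sub>F u in nhds t. (0::real) = (max 0 u)\<^sup>2"
      using eventually_nhds_in_open[of "{..<0}" t] 1 by (auto elim: eventually_mono)
    ultimately show ?thesis using 1 DERIV_cong_ev[OF refl _ refl, of "\<lambda>_. 0" "\<lambda>t. (max 0 t)\<^sup>2" t 0] by simp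
  next
    case 2
    have "((\<lambda>h::real. ((max 0 h)\<^sup>2) / h) \<longlongrightarrow> 0) (at 0)"
    proof (rule Lim_null_comparison)
      show "\<forall>\<^sub>F h in at (0::real). norm ((max 0 h)\<^sup>2 / h) \<le> \<bar>h\<bar>"
        by (intro always_eventually) (auto simp: max_def power2_eq_square)
      show "((\<lambda>h::real. \<bar>h\<bar>) \<longlongrightarrow> 0) (at 0)" by (intro tendsto_rabs_zero tendsto_ident_at)
    qed
    with 2 show ?thesis by (simp add: DERIV_def)
  next
    case 3
    have "((\<lambda>t::real. t\<^sup>2) has_real_derivative 2 * t) (at t)" by (auto intro!: derivative_eq_intros)
    moreover have "\<forall>\<^sub>F u in nhds t. u\<^sup>2 = (max 0 u)\<^sup>2"
      using eventually_nhds_in_open[of "{0<..}" t] 3 by (auto elim!: eventually_mono simp: max_def)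
    ultimately show ?thesis using 3 by (subst DERIV_cong_ev[OF refl _ refl, symmetric]) auto
  qed
qed

section \<open>Uniqueness of the derivatives and criteria for their existence\<close>

lemma horizontal_derivI: "has_horizontal_deriv T f p D \<Longrightarrow> horizontal_deriv T f p = D"
  unfolding horizontal_deriv_def
proof (rule the_equality)
  fix D' assume a: "has_horizontal_deriv T f p D" "has_horizontal_deriv T f p D'"
  obtain s \<gamma> where p: "p = (s, \<gamma>)" by (cases p)
  have u: "E = E'" if "has_horizontal_deriv0 f q E" "has_horizontal_deriv0 f q E'" for q E E'
    using that unfolding has_horizontal_deriv0_def
    by (cases q) (auto intro: tendsto_unique[OF trivial_limit_at_right_real])
  show "D' = D"
  proof (cases "s < T")
    case True
    then show ?thesis using a u unfolding p has_horizontal_deriv_def by auto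
  next
    case False
    then obtain \<phi> \<psi> where
      "\<forall>\<^sub>F r in at_left T. has_horizontal_deriv0 f (r, restrict \<gamma> {0..r}) (\<phi> r)"
      "\<forall>\<^sub>F r in at_left T. has_horizontal_deriv0 f (r, restrict \<gamma> {0..r}) (\<psi> r)"
      and l: "(\<phi> \<longlongrightarrow> D) (at_left T)" "(\<psi> \<longlongrightarrow> D') (at_left T)"
      using a unfolding p has_horizontal_deriv_def by auto
    then have "\<forall>\<^sub>F r in at_left T. \<phi> r = \<psi> r" by (auto elim: eventually_elim2 intro: u)
    with l(1) have "(\<psi> \<longlongrightarrow> D) (at_left T)" by (rule Lim_transform_eventually)
    with l(2) show ?thesis by (rule tendsto_unique[OF trivial_limit_at_left_real])
  qed
qed

lemma has_vertical_deriv_unique: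
  assumes "has_vertical_deriv f i p D" "has_vertical_deriv f i p D'" shows "D = D'"
  using assms unfolding has_vertical_deriv_def by (cases p) (auto intro: tendsto_unique[OF at_neq_bot])

lemma vertical_derivI: "has_vertical_deriv f i p D \<Longrightarrow> vertical_deriv f p $ i = D"
  unfolding vertical_deriv_def by (auto intro: has_vertical_deriv_unique)

text \<open>Exhibiting explicit continuous functionals as derivatives bypasses the definite
  descriptions; these need to agree with them only on \<open>cadlag_space T t\<close>.\<close>

lemma C1_cadlagI:
  assumes "f \<in> C0_cadlag T t"
    and H: "\<And>p. p \<in> cadlag_space T t \<Longrightarrow> has_horizontal_deriv T f p (H p)" and H0: "H \<in> C0_cadlag T t"
    and V: "\<And>i p. p \<in> cadlag_space T t \<Longrightarrow> has_vertical_deriv f i p (V p $ i)"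
    and V0: "\<And>i. (\<lambda>p. V p $ i) \<in> C0_cadlag T t"
  shows "f \<in> C1_cadlag T t"
proof -
  have "horizontal_deriv T f \<in> C0_cadlag T t"
    by (rule C0_cadlag_cong[OF H0]) (simp add: horizontal_derivI[OF H])
  moreover have "(\<lambda>p. vertical_deriv f p $ i) \<in> C0_cadlag T t" for i
    by (rule C0_cadlag_cong[OF V0[of i]]) (simp add: vertical_derivI[OF V])
  ultimately show ?thesis using assms unfolding C1_cadlag_def by blast
qed

lemma C0_cadlag_const: "(\<lambda>_. c) \<in> C0_cadlag T t"
  by (auto simp: C0_cadlag_def intro: exI[of _ 1])

text \<open>\<open>D\<close> is kept apart from \<open>\<phi> (s, \<gamma>)\<close> because at the
  final time it is a left limit, which a jump at \<open>T\<close> can separate from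
  \<open>\<phi> (T, \<gamma>)\<close>.\<close>

lemma has_horizontal_derivI:
  fixes \<phi> :: "'n::finite path \<Rightarrow> real"
  assumes p: "(s, \<gamma>) \<in> cadlag_space T t" and T: "t < T"
    and H: "\<And>r \<eta>. \<eta> \<in> cadlag_paths r \<Longrightarrow> t \<le> r \<Longrightarrow> r < T \<Longrightarrow> has_horizontal_deriv0 f (r, \<eta>) (\<phi> (r, \<eta>))"
    and D: "s < T \<Longrightarrow> D = \<phi> (s, \<gamma>)"
    and lim: "s = T \<Longrightarrow> ((\<lambda>r. \<phi> (r, restrict \<gamma> {0..r})) \<longlongrightarrow> D) (at_left T)"
  shows "has_horizontal_deriv T f (s, \<gamma>) D"
proof (cases "s < T")
  case True
  with p D H show ?thesis by (auto simp: has_horizontal_deriv_def cadlag_space_def)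
next
  case False
  with p have s: "s = T" and g: "\<gamma> \<in> cadlag_paths T" by (auto simp: cadlag_space_def)
  have "\<forall>\<^sub>F r in at_left T. has_horizontal_deriv0 f (r, restrict \<gamma> {0..r}) (\<phi> (r, restrict \<gamma> {0..r}))"
    unfolding eventually_at_left_field using T
    by (intro exI[of _ t]) (auto intro!: H restrict_cadlag[OF g])
  with lim[OF s] show ?thesis unfolding has_horizontal_deriv_def s by auto
qed

context
  fixes T t0 :: real and a :: "real \<Rightarrow> real^'n"
  assumes t0: "0 \<le> t0" and a: "a \<in> cadlag_paths t0"
begin

lemma S_from_eq:
  assumes "t0 \<le> s"
  shows "S_from t0 a (s, \<gamma>) = ((dev t0 a (s, \<gamma>))\<^sup>2 - (norm (gap t0 a (s, \<gamma>)))\<^sup>2)\<^sup>2 / (dev t0 a (s, \<gamma>))\<^sup>2"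
  using assms t0 by (simp add: S_from_def S_fun_def dev_def gap_def extend_apply Let_def)

lemma S_from_C0: "S_from t0 a \<in> C0_cadlag T t0"
  by (rule C0_cadlag_cong[OF C0_cadlag_compose[OF dev_gap_lipschitz[OF t0 a] _ S_quotient_continuous dev_gap_range[OF t0 a]]])
    (auto simp: S_from_eq cadlag_space_def)

lemma S_grad_C0: "(\<lambda>p. S_grad t0 a p $ i) \<in> C0_cadlag T t0"
  by (rule C0_cadlag_cong[OF C0_cadlag_compose[OF dev_gap_lipschitz[OF t0 a] _ S_gradient_continuous[of i] dev_gap_range[OF t0 a]]])
    (auto simp: S_grad_nth)

lemma S_from_extend:
  assumes "\<gamma> \<in> cadlag_paths s" "t0 \<le> s" "s \<le> r"
  shows "S_from t0 a (r, extend s \<gamma> r) = S_from t0 a (s, \<gamma>)"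
  using assms t0 by (simp add: S_from_eq dev_extend[OF t0 a] gap_extend)

lemma S_from_horizontal0:
  assumes "\<gamma> \<in> cadlag_paths s" "t0 \<le> s"
  shows "has_horizontal_deriv0 (S_from t0 a) (s, \<gamma>) 0"
  unfolding has_horizontal_deriv0_def prod.case
  by (rule tendsto_eventually)
    (auto simp: eventually_at_filter S_from_extend[OF assms])

lemma S_from_vertical:
  assumes p: "(s, \<gamma>) \<in> cadlag_space T t0"
  shows "has_vertical_deriv (S_from t0 a) i (s, \<gamma>) (S_grad t0 a (s, \<gamma>) $ i)"
proof -
  have g: "\<gamma> \<in> cadlag_paths s" and s: "t0 \<le> s" using p by (auto simp: cadlag_space_def)
  obtain M where M: "0 \<le> M" "\<And>x. dev t0 a (s, bump s \<gamma> x) = max M (norm (gap t0 a (s, \<gamma>) + x))"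
    using dev_bump[OF t0 a g s] by metis
  define y where "y = gap t0 a (s, \<gamma>)"
  have N: "dev t0 a (s, \<gamma>) = max M (norm y)" using M(2)[of 0] by (simp add: bump_def y_def)
  \<comment> \<open>The denominator can stay \<open>M\<^sup>2\<close>: once
    \<open>norm (y + x)\<close> exceeds \<open>M\<close>, the sup distance is the final distance and
    both sides vanish.\<close>
  have S: "S_from t0 a (s, bump s \<gamma> x) = (max 0 (M\<^sup>2 - (norm (y + x))\<^sup>2))\<^sup>2 / M\<^sup>2" for x
  proof -
    have "gap t0 a (s, bump s \<gamma> x) = y + x" by (simp add: gap_def bump_def y_def)
    moreover have "(norm (y + x))\<^sup>2 \<le> M\<^sup>2 \<longleftrightarrow> norm (y + x) \<le> M"
      using M(1) by (simp add: abs_le_square_iff[symmetric])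
    ultimately show ?thesis by (cases "norm (y + x) \<le> M") (auto simp: S_from_eq[OF s] M(2) y_def[symmetric] max_def)
  qed
  let ?P = "\<lambda>h. (norm y)\<^sup>2 + 2 * h * (y $ i) + h\<^sup>2"
  have P: "(norm (y + h *\<^sub>R axis i 1))\<^sup>2 = ?P h" for h
  proof -
    have "(norm (y + h *\<^sub>R axis i 1))\<^sup>2 = (norm y)\<^sup>2 + 2 * (y \<bullet> (h *\<^sub>R axis i 1)) + (norm (h *\<^sub>R axis i (1::real)))\<^sup>2"
      unfolding power2_norm_eq_inner by (simp add: inner_add_left inner_add_right inner_commute)
    then show ?thesis by (simp add: inner_axis norm_axis_1)
  qed
  have "((\<lambda>h. M\<^sup>2 - ?P h) has_real_derivative - (2 * (y $ i))) (at 0)"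
    by (auto intro!: derivative_eq_intros)
  from DERIV_chain2[OF has_real_derivative_max0_sq, OF this]
  have "((\<lambda>h. (max 0 (M\<^sup>2 - ?P h))\<^sup>2 / M\<^sup>2) has_real_derivative 
     2 * max 0 (M\<^sup>2 - ?P 0) * (- (2 * (y $ i))) / M\<^sup>2) (at 0)"
    by (rule DERIV_cdivide)
  then have "((\<lambda>h. S_from t0 a (s, bump s \<gamma> (h *\<^sub>R axis i 1))) has_real_derivative 
     2 * max 0 (M\<^sup>2 - (norm y)\<^sup>2) * (- (2 * (y $ i))) / M\<^sup>2) (at 0)"
    by (simp add: S P)
  moreover have "2 * max 0 (M\<^sup>2 - (norm y)\<^sup>2) * (- (2 * (y $ i))) / M\<^sup>2 = S_grad t0 a (s, \<gamma>) $ i"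
  proof -
    have "(norm y)\<^sup>2 \<le> M\<^sup>2 \<longleftrightarrow> norm y \<le> M"
      using M(1) by (simp add: abs_le_square_iff[symmetric])
    then show ?thesis
      by (cases "norm y \<le> M") (auto simp: S_grad_nth N y_def[symmetric] max_def)
  qed
  moreover have "S_from t0 a (s, bump s \<gamma> 0) = S_from t0 a (s, \<gamma>)" by (simp add: bump_def)
  ultimately show ?thesis
    by (simp add: has_vertical_deriv_def DERIV_def)
qed

lemma S_from_C1:
  assumes T: "t0 < T"
  shows "S_from t0 a \<in> C1_cadlag T t0"
proof (rule C1_cadlagI[OF S_from_C0 _ C0_cadlag_const _ S_grad_C0])
  fix p :: "'n path" and i assume p: "p \<in> cadlag_space T t0"
  show "has_horizontal_deriv T (S_from t0 a) p 0"
    by (cases p) (use p T S_from_horizontal0 in \<open>auto intro!: has_horizontal_derivI[where \<phi> = "\<lambda>_. 0"]\<close>)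
  show "has_vertical_deriv (S_from t0 a) i p (S_grad t0 a p $ i)"
    by (cases p) (use p S_from_vertical in auto)
qed

end

section \<open>Regularity of g\<close>

lemma set_integral_dist_le:
  fixes f g :: "real \<Rightarrow> real"
  assumes "set_integrable lborel {0..T} f" "set_integrable lborel {0..T} g" "0 \<le> T"
    and le: "\<And>u. 0 \<le> u \<Longrightarrow> \<bar>f u - g u\<bar> \<le> c"
  shows "\<bar>(LBINT u:{0..T}. f u) - (LBINT u:{0..T}. g u)\<bar> \<le> T * c"
proof -
  have int: "set_integrable lborel {0..T} (\<lambda>_. c)"
    using assms(3) by (simp add: set_integrable_def)
  have c: "(LBINT u:{0..T}. c) = T * c"
    using assms(3) by (simp add: set_lebesgue_integral_def)
  have "(LBINT u:{0..T}. f u - g u) \<le> (LBINT u:{0..T}. c)"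
    using le by (intro set_integral_mono set_integral_diff assms int) (auto simp: abs_le_iff)
  moreover have "(LBINT u:{0..T}. g u - f u) \<le> (LBINT u:{0..T}. c)"
    using le by (intro set_integral_mono set_integral_diff assms int) (auto simp: abs_le_iff)
  ultimately show ?thesis
    unfolding set_integral_diff(2)[OF assms(1,2)] set_integral_diff(2)[OF assms(2,1)] c by linarith
qed

text \<open>The integrand of \<open>g\<close> with clamped times: defined on the whole line, it
  allows paths with different final times to be integrated over the same interval.\<close>

definition sq_dev :: "real \<Rightarrow> (real \<Rightarrow> real^'n) \<Rightarrow> 'n::finite path \<Rightarrow> real \<Rightarrow> real" where
  "sq_dev t0 a = (\<lambda>(s, \<gamma>) u. (norm (\<gamma> (max 0 (min u s)) - a (max 0 (min u t0))))\<^sup>2)"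

text \<open>
  The horizontal derivative of \<open>g\<close> at the final time \<open>T\<close> involves the left limit at \<open>T\<close>, so for a
  path jumping at \<open>T\<close> it differs from the value suggested by \<open>gap\<close>. Paths living up to \<open>s < T\<close> are
  frozen near \<open>T\<close>, which makes one definition cover both cases.
\<close>

definition left_gap :: "real \<Rightarrow> real \<Rightarrow> (real \<Rightarrow> real^'n) \<Rightarrow> 'n::finite path \<Rightarrow> real^'n" where
  "left_gap T t0 a = (\<lambda>(s, \<gamma>). Lim (at_left T) (\<lambda>r. \<gamma> (min r s)) - a t0)"

context
  fixes T t0 :: real and a :: "real \<Rightarrow> real^'n"
  assumes t0: "0 \<le> t0" and a: "a \<in> cadlag_paths t0"
begin

lemma sq_dev_integrable:
  assumes g: "\<gamma> \<in> cadlag_paths s" and s: "t0 \<le> s" and A: "A \<in> sets borel" "emeasure lborel A < \<infinity>"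
  shows "set_integrable lborel A (sq_dev t0 a (s, \<gamma>))"
  unfolding set_integrable_def
proof (rule integrableI_bounded_set_indicator)
  have "(\<lambda>u. \<gamma> (max 0 (min u s)) - a (max 0 (min u t0))) \<in> borel_measurable borel"
    using s t0 by (intro borel_measurable_diff cadlag_measurable g a) auto
  then show "sq_dev t0 a (s, \<gamma>) \<in> borel_measurable lborel" unfolding sq_dev_def by simp
  have "max 0 (min u s) = min (max 0 u) s" "max 0 (min u t0) = min (max 0 u) t0" for u
    using s t0 by auto
  then have "norm (sq_dev t0 a (s, \<gamma>) u) \<le> (dev t0 a (s, \<gamma>))\<^sup>2" for u
    using dev_upper[OF t0 a g s, of "max 0 u"] by (simp add: sq_dev_def power_mono)
  then show "AE u\<in>A in lborel. norm (sq_dev t0 a (s, \<gamma>) u) \<le> (dev t0 a (s, \<gamma>))\<^sup>2" by simp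
qed (use A in auto)

lemma g_from_eq:
  assumes "t0 \<le> s"
  shows "g_from t0 a (s, \<gamma>) = (LBINT u:{0..s}. sq_dev t0 a (s, \<gamma>) u)"
  unfolding g_from_def prod.case using assms t0
  by (intro set_lebesgue_integral_cong) (auto simp: sq_dev_def extend_apply min_absorb1)

lemma g_from_extend:
  assumes g: "\<gamma> \<in> cadlag_paths s" and s: "t0 \<le> s" "s \<le> r"
  shows "g_from t0 a (r, extend s \<gamma> r) = (LBINT u:{0..r}. sq_dev t0 a (s, \<gamma>) u)" (is ?A)
    "g_from t0 a (r, extend s \<gamma> r) = g_from t0 a (s, \<gamma>) + (r - s) * (norm (gap t0 a (s, \<gamma>)))\<^sup>2" (is ?B)
proof -
  show ?A
    using s t0 by (subst g_from_eq)
      (auto intro!: set_lebesgue_integral_cong simp: sq_dev_def extend_apply min_absorb1)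
  also have "{0..r} = {0..s} \<union> {s<..r}" using s t0 by auto
  also have "(LBINT u:\<dots>. sq_dev t0 a (s, \<gamma>) u) =
      (LBINT u:{0..s}. sq_dev t0 a (s, \<gamma>) u) + (LBINT u:{s<..r}. sq_dev t0 a (s, \<gamma>) u)"
    using s t0 by (intro set_integral_Un sq_dev_integrable[OF g]) auto
  also have "(LBINT u:{s<..r}. sq_dev t0 a (s, \<gamma>) u) = (LBINT u:{s<..r}. (norm (gap t0 a (s, \<gamma>)))\<^sup>2)"
    using s t0 by (intro set_lebesgue_integral_cong) (auto simp: sq_dev_def gap_def min_absorb2)
  also have "\<dots> = (r - s) * (norm (gap t0 a (s, \<gamma>)))\<^sup>2"
    using s by (simp add: set_lebesgue_integral_def)
  finally show ?B using s by (simp add: g_from_eq)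
qed

lemma sq_dev_diff_le:
  assumes p: "p \<in> cadlag_space T t0" and q: "q \<in> cadlag_space T t0"
  shows "\<bar>sq_dev t0 a q u - sq_dev t0 a p u\<bar> \<le> d_infty p q * (2 * dev t0 a p + d_infty p q)"
proof -
  obtain s \<gamma> r \<eta> where pq: "p = (s, \<gamma>)" "q = (r, \<eta>)" by (cases p, cases q)
  have g: "\<gamma> \<in> cadlag_paths s" "t0 \<le> s" and e: "\<eta> \<in> cadlag_paths r" "t0 \<le> r"
    using p q by (auto simp: pq cadlag_space_def)
  define v where "v = max 0 u"
  define x where "x = \<gamma> (min v s) - a (min v t0)"
  define y where "y = \<eta> (min v r) - a (min v t0)"
  have v: "max 0 (min u s) = min v s" "max 0 (min u r) = min v r" "max 0 (min u t0) = min v t0"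
    using g e t0 by (auto simp: v_def)
  have "0 \<le> v" by (simp add: v_def)
  then have x: "norm x \<le> dev t0 a p" unfolding x_def pq by (rule dev_upper[OF t0 a g])
  have xy: "norm (x - y) \<le> d_infty p q"
    using d_infty_ge[OF g(1) e(1) _ _ \<open>0 \<le> v\<close>] g e t0 unfolding pq x_def y_def by (simp add: v)
  have "\<bar>(norm y)\<^sup>2 - (norm x)\<^sup>2\<bar> = \<bar>norm y - norm x\<bar> * (norm y + norm x)"
    by (simp add: power2_eq_square square_diff_square_factored abs_mult mult.commute)
  also have "\<dots> \<le> d_infty p q * (2 * dev t0 a p + d_infty p q)"
    using x xy norm_triangle_ineq3[of y x] norm_triangle_sub[of y x] norm_ge_zero[of "x - y"]
    by (intro mult_mono) (auto simp: norm_minus_commute)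
  finally show ?thesis by (simp add: pq sq_dev_def v x_def y_def)
qed

lemma g_from_C0:
  assumes T: "t0 < T"
  shows "g_from t0 a \<in> C0_cadlag T t0"
proof -
  define G where "G p = (LBINT u:{0..T}. sq_dev t0 a p u)" for p
  have "G \<in> C0_cadlag T t0"
    unfolding C0_cadlag_def mem_Collect_eq
  proof (intro ballI allI impI)
    fix p :: "'n path" and \<epsilon> :: real assume p: "p \<in> cadlag_space T t0" and \<epsilon>: "\<epsilon> > 0"
    define N where "N = dev t0 a p"
    have N: "0 \<le> N" using p gap_le_dev[OF t0 a] order_trans[OF norm_ge_zero]
      unfolding N_def by (cases p) (fastforce simp: cadlag_space_def)
    \<comment> \<open>The cap 1 turns \<open>2 * N + d_infty p q\<close> into at most
      \<open>2 * N + 1\<close>, making the bound linear in the distance; the added 1 keeps the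
      denominator positive.\<close>
    define \<delta> where "\<delta> = min 1 (\<epsilon> / (T * (2 * N + 1) + 1))"
    have pos: "T * (2 * N + 1) + 1 > 0" using T t0 N by (intro add_nonneg_pos mult_nonneg_nonneg) auto
    have "\<bar>G q - G p\<bar> < \<epsilon>" if q: "q \<in> cadlag_space T t0" and d: "d_infty p q < \<delta>" for q
    proof -
      have d0: "0 \<le> d_infty p q"
        using dev_lipschitz[OF t0 a p q] by linarith
      have "\<bar>G q - G p\<bar> \<le> T * (d_infty p q * (2 * N + d_infty p q))"
        unfolding G_def N_def using sq_dev_diff_le[OF p q] p q T t0
        by (intro set_integral_dist_le) (auto simp: cadlag_space_def intro!: sq_dev_integrable)
      also have "\<dots> \<le> T * (d_infty p q * (2 * N + 1))"
        using d d0 T t0 by (intro mult_left_mono) (auto simp: \<delta>_def)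
      also have "\<dots> \<le> d_infty p q * (T * (2 * N + 1) + 1)" using d0 by (simp add: algebra_simps)
      also have "\<dots> < \<epsilon>" using d pos by (simp add: \<delta>_def field_simps)
      finally show ?thesis .
    qed
    moreover have "\<delta> > 0" using \<epsilon> pos by (simp add: \<delta>_def)
    ultimately show "\<exists>\<delta>>0. \<forall>q\<in>cadlag_space T t0. d_infty p q < \<delta> \<longrightarrow> \<bar>G q - G p\<bar> < \<epsilon>" by blast
  qed
  moreover have "(\<lambda>p. (\<lambda>x. (T - fst x) * (norm (snd x))\<^sup>2) (fst p, gap t0 a p)) \<in> C0_cadlag T t0"
  proof (rule C0_cadlag_compose[where m = "\<lambda>p. (fst p, gap t0 a p)" and D = UNIV and K = 1])
    fix p q :: "'n path" assume pq: "p \<in> cadlag_space T t0" "q \<in> cadlag_space T t0"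
    have "dist (fst p, gap t0 a p) (fst q, gap t0 a q) \<le> \<bar>fst p - fst q\<bar> + norm (gap t0 a p - gap t0 a q)"
      unfolding dist_Pair_Pair by (intro order_trans[OF sqrt_sum_squares_le_sum]) (auto simp: dist_norm)
    with time_gap_lipschitz[OF t0 a pq]
    show "dist (fst p, gap t0 a p) (fst q, gap t0 a q) \<le> 1 * d_infty p q" by simp
  qed (auto intro!: continuous_intros)
  ultimately have "(\<lambda>p. G p - (T - fst p) * (norm (gap t0 a p))\<^sup>2) \<in> C0_cadlag T t0"
    by (auto dest: C0_cadlag_diff)
  then show ?thesis
  proof (rule C0_cadlag_cong)
    fix p :: "'n path" assume p: "p \<in> cadlag_space T t0"
    obtain s \<gamma> where s: "p = (s, \<gamma>)" by (cases p)
    with p have "\<gamma> \<in> cadlag_paths s" "t0 \<le> s" "s \<le> T" by (auto simp: cadlag_space_def)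
    from g_from_extend[OF this] show "G p - (T - fst p) * (norm (gap t0 a p))\<^sup>2 = g_from t0 a p"
      by (simp add: G_def s)
  qed
qed

lemma left_gap_tendsto:
  assumes p: "(s, \<gamma>) \<in> cadlag_space T t0" and T: "t0 < T"
  shows "((\<lambda>r. \<gamma> (min r s)) \<longlongrightarrow> left_gap T t0 a (s, \<gamma>) + a t0) (at_left T)"
    and "s < T \<Longrightarrow> left_gap T t0 a (s, \<gamma>) = gap t0 a (s, \<gamma>)"
proof -
  have ev: "\<forall>\<^sub>F r in at_left T. \<gamma> (min r s) = \<gamma> s" if "s < T"
    unfolding eventually_at_left_field using that by (intro exI[of _ s]) auto
  have lim: "((\<lambda>r. \<gamma> (min r s)) \<longlongrightarrow> \<gamma> s) (at_left T)" if "s < T"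
    using ev[OF that] by (rule tendsto_eventually)
  have "\<exists>l. ((\<lambda>r. \<gamma> (min r s)) \<longlongrightarrow> l) (at_left T)"
  proof (cases "s < T")
    case False
    with p have s: "s = T" and g: "\<gamma> \<in> cadlag_paths T" by (auto simp: cadlag_space_def)
    obtain l where "(\<gamma> \<longlongrightarrow> l) (at_left T)" using cadlag_left_limit[OF g, of T] T t0 by auto
    moreover have "\<forall>\<^sub>F r in at_left T. \<gamma> r = \<gamma> (min r s)"
      unfolding eventually_at_left_field s by (intro exI[of _ "T - 1"]) auto
    ultimately show ?thesis by (blast intro: Lim_transform_eventually)
  qed (use lim in blast)
  then obtain l where l: "((\<lambda>r. \<gamma> (min r s)) \<longlongrightarrow> l) (at_left T)" by blast
  have *: "Lim (at_left T) (\<lambda>r. \<gamma> (min r s)) = l" by (rule tendsto_Lim[OF trivial_limit_at_left_real l])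
  with l show "((\<lambda>r. \<gamma> (min r s)) \<longlongrightarrow> left_gap T t0 a (s, \<gamma>) + a t0) (at_left T)"
    by (simp add: left_gap_def)
  show "left_gap T t0 a (s, \<gamma>) = gap t0 a (s, \<gamma>)" if "s < T"
    using tendsto_Lim[OF trivial_limit_at_left_real lim[OF that]] by (simp add: left_gap_def gap_def)
qed

text \<open>The path distance bounds the difference at every time before \<open>T\<close>, and this
  bound survives the left limit.\<close>

lemma left_gap_lipschitz:
  assumes p: "p \<in> cadlag_space T t0" and q: "q \<in> cadlag_space T t0" and T: "t0 < T"
  shows "dist (left_gap T t0 a p) (left_gap T t0 a q) \<le> 1 * d_infty p q"
proof -
  obtain s \<gamma> r \<eta> where pq: "p = (s, \<gamma>)" "q = (r, \<eta>)" by (cases p, cases q)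
  have g: "\<gamma> \<in> cadlag_paths s" "t0 \<le> s" and e: "\<eta> \<in> cadlag_paths r" "t0 \<le> r"
    using p q by (auto simp: pq cadlag_space_def)
  have "((\<lambda>u. norm (\<gamma> (min u s) - \<eta> (min u r))) \<longlongrightarrow>
      norm ((left_gap T t0 a p + a t0) - (left_gap T t0 a q + a t0))) (at_left T)"
    using p q unfolding pq by (intro tendsto_intros left_gap_tendsto T)
  moreover have "\<forall>\<^sub>F u in at_left T. norm (\<gamma> (min u s) - \<eta> (min u r)) \<le> d_infty p q"
    unfolding eventually_at_left_field
  proof (intro exI[of _ 0] conjI allI impI)
    fix u :: real assume "0 < u"
    then show "norm (\<gamma> (min u s) - \<eta> (min u r)) \<le> d_infty p q"
      using d_infty_ge[OF g(1) e(1), of u] g e t0 unfolding pq by simp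
  qed (use T t0 in simp)
  ultimately have "norm ((left_gap T t0 a p + a t0) - (left_gap T t0 a q + a t0)) \<le> d_infty p q"
    by (rule tendsto_upperbound) simp
  then show ?thesis by (simp add: dist_norm)
qed

lemma g_from_horizontal0:
  assumes "\<gamma> \<in> cadlag_paths s" "t0 \<le> s"
  shows "has_horizontal_deriv0 (g_from t0 a) (s, \<gamma>) ((norm (gap t0 a (s, \<gamma>)))\<^sup>2)"
  unfolding has_horizontal_deriv0_def prod.case
  \<comment> \<open>Along a frozen path \<open>g\<close> is affine in time, so the difference
    quotient is constant.\<close>
  by (rule tendsto_eventually) (auto simp: eventually_at_filter g_from_extend(2)[OF assms])

lemma g_from_vertical:
  assumes p: "(s, \<gamma>) \<in> cadlag_space T t0"
  shows "has_vertical_deriv (g_from t0 a) i (s, \<gamma>) 0"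
proof -
  have "g_from t0 a (s, bump s \<gamma> x) = g_from t0 a (s, \<gamma>)" for x
    unfolding g_from_def prod.case set_lebesgue_integral_def
    \<comment> \<open>A bump changes the integrand at the single point \<open>s\<close>
      only.\<close>
    by (rule integral_discrete_difference[where X = "{s}"]) (auto simp: bump_def)
  then show ?thesis by (simp add: has_vertical_deriv_def)
qed

lemma g_from_C1:
  assumes T: "t0 < T"
  shows "g_from t0 a \<in> C1_cadlag T t0"
proof (rule C1_cadlagI[OF g_from_C0[OF T], where H = "\<lambda>p. (norm (left_gap T t0 a p))\<^sup>2" and V = "\<lambda>_. 0"])
  show "(\<lambda>p. (norm (left_gap T t0 a p))\<^sup>2) \<in> C0_cadlag T t0"
    by (rule C0_cadlag_compose[OF left_gap_lipschitz[OF _ _ T] _ _ subset_UNIV]) (auto intro!: continuous_intros)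
  fix p :: "'n path" and i assume p: "p \<in> cadlag_space T t0"
  obtain s \<gamma> where s: "p = (s, \<gamma>)" by (cases p)
  show "has_vertical_deriv (g_from t0 a) i p (0 $ i)"
    using g_from_vertical p by (simp add: s)
  show "has_horizontal_deriv T (g_from t0 a) p ((norm (left_gap T t0 a p))\<^sup>2)"
    unfolding s
  proof (rule has_horizontal_derivI[OF _ T, where \<phi> = "\<lambda>p. (norm (gap t0 a p))\<^sup>2"])
    show "((\<lambda>r. (norm (gap t0 a (r, restrict \<gamma> {0..r})))\<^sup>2) \<longlongrightarrow> (norm (left_gap T t0 a (s, \<gamma>)))\<^sup>2) (at_left T)"
      if "s = T"
    proof (rule Lim_transform_eventually)
      show "((\<lambda>r. (norm (\<gamma> (min r s) - a t0))\<^sup>2) \<longlongrightarrow> (norm (left_gap T t0 a (s, \<gamma>)))\<^sup>2) (at_left T)"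
        using tendsto_diff[OF left_gap_tendsto(1)[OF _ T, of s \<gamma>] tendsto_const[of "a t0"]] p s
        by (intro tendsto_intros) simp
      show "\<forall>\<^sub>F r in at_left T. (norm (\<gamma> (min r s) - a t0))\<^sup>2 = (norm (gap t0 a (r, restrict \<gamma> {0..r})))\<^sup>2"
        unfolding eventually_at_left_field using T t0 that by (intro exI[of _ 0]) (auto simp: gap_def)
    qed
  qed (use p s g_from_horizontal0 left_gap_tendsto(2)[OF _ T] in auto)
qed (simp add: C0_cadlag_const)

lemma g_from_path:
  assumes X: "restrict X {0..s} \<in> cadlag_paths s" and s: "t0 \<le> s"
  shows "g_from t0 a (path_upto X s) = g_from t0 a (path_upto X t0) + (LBINT \<sigma>:{t0..s}. (norm (X \<sigma> - a t0))\<^sup>2)"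
proof -
  let ?E = "sq_dev t0 a (s, restrict X {0..s})"
  have "g_from t0 a (path_upto X s) = (LBINT u:{0..s}. ?E u)"
    using s by (simp add: path_upto_def g_from_eq)
  also have "\<dots> = (LBINT u:{0..t0}. ?E u) + (LBINT u:{t0<..s}. ?E u)"
  proof -
    have "{0..s} = {0..t0} \<union> {t0<..s}" using s t0 by auto
    moreover have "(LBINT u:{0..t0} \<union> {t0<..s}. ?E u) = (LBINT u:{0..t0}. ?E u) + (LBINT u:{t0<..s}. ?E u)"
      using s t0 by (intro set_integral_Un sq_dev_integrable[OF X]) auto
    ultimately show ?thesis by metis
  qed
  also have "(LBINT u:{0..t0}. ?E u) = g_from t0 a (path_upto X t0)"
  proof -
    have "?E u = sq_dev t0 a (t0, restrict X {0..t0}) u" if "u \<in> {0..t0}" for u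
    proof -
      have "max 0 (min u s) = u" "max 0 (min u t0) = u" "u \<in> {0..s}" using that s by auto
      with that show ?thesis by (simp add: sq_dev_def)
    qed
    then have "(LBINT u:{0..t0}. ?E u) = (LBINT u:{0..t0}. sq_dev t0 a (t0, restrict X {0..t0}) u)"
      by (intro set_lebesgue_integral_cong) auto
    then show ?thesis by (simp add: path_upto_def g_from_eq)
  qed
  also have "(LBINT u:{t0<..s}. ?E u) = (LBINT u:{t0..s}. ?E u)"
    by (rule set_integral_discrete_difference[where X = "{t0}"]) auto
  also have "\<dots> = (LBINT \<sigma>:{t0..s}. (norm (X \<sigma> - a t0))\<^sup>2)"
  proof -
    have "?E u = (norm (X u - a t0))\<^sup>2" if "u \<in> {t0..s}" for u
    proof -
      have "max 0 (min u s) = u" "max 0 (min u t0) = t0" "u \<in> {0..s}" using that s t0 by auto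
      then show ?thesis by (simp add: sq_dev_def)
    qed
    then show ?thesis by (intro set_lebesgue_integral_cong) auto
  qed
  finally show ?thesis .
qed

end

section \<open>Uniqueness of the vertical derivative\<close>

lemma restrict_cont_paths:
  assumes "continuous_on {0..T} X" "s \<le> T"
  shows "restrict X {0..s} \<in> cont_paths s"
proof -
  have "continuous_on {0..s} X" by (rule continuous_on_subset[OF assms(1)]) (use assms(2) in auto)
  then have "continuous_on {0..s} (restrict X {0..s})" by (rule continuous_on_eq) simp
  then show ?thesis by (simp add: cont_paths_def)
qed

lemma path_upto_cont_space:
  assumes "continuous_on {0..T} X" "t \<le> s" "s \<le> T"
  shows "path_upto X s \<in> cont_space T t"
  using assms by (simp add: path_upto_def cont_space_def restrict_cont_paths)

text \<open>Uniform continuity controls \<open>X\<close> between two clamped times, leaving half of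
  the tolerance for the time difference. It serves both to reach the final time in the uniqueness
  proof and to make the Stieltjes integrand continuous.\<close>

lemma path_upto_continuous:
  fixes X :: "real \<Rightarrow> real^'n"
  assumes X: "continuous_on {0..T} X" and f: "f \<in> C0_cadlag T t" and t: "0 \<le> t"
  shows "continuous_on {t..T} (\<lambda>s. f (path_upto X s))"
  unfolding continuous_on_iff
proof (intro ballI allI impI)
  fix s \<epsilon> :: real assume s: "s \<in> {t..T}" and "0 < \<epsilon>"
  have cs: "path_upto X r \<in> cadlag_space T t" if "r \<in> {t..T}" for r
    using path_upto_cont_space[OF X, of t r] cont_space_subset[of T t] that by auto
  obtain \<delta> where \<delta>: "\<delta> > 0"
    "\<And>q. q \<in> cadlag_space T t \<Longrightarrow> d_infty (path_upto X s) q < \<delta> \<Longrightarrow> \<bar>f q - f (path_upto X s)\<bar> < \<epsilon>"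
    using C0_cadlagE[OF f cs[OF s] \<open>0 < \<epsilon>\<close>] by metis
  have "uniformly_continuous_on {0..T} X" using X by (simp add: compact_uniformly_continuous)
  with \<delta>(1) obtain d where d: "d > 0"
    "\<And>u v. u \<in> {0..T} \<Longrightarrow> v \<in> {0..T} \<Longrightarrow> dist v u < d \<Longrightarrow> dist (X v) (X u) < \<delta> / 2"
    unfolding uniformly_continuous_on_def by (metis half_gt_zero)
  have "dist (f (path_upto X r)) (f (path_upto X s)) < \<epsilon>" if r: "r \<in> {t..T}" "dist r s < min d (\<delta> / 2)" for r
  proof -
    have "d_infty (path_upto X s) (path_upto X r) \<le> \<bar>s - r\<bar> + \<delta> / 2"
      unfolding path_upto_def
    proof (rule d_infty_le)
      fix u assume u: "0 \<le> u" "u \<le> max s r"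
      have "\<bar>min u s - min u r\<bar> \<le> \<bar>r - s\<bar>" by (simp add: min_def abs_minus_commute)
      then have "dist (min u s) (min u r) < d" using r(2) by (simp add: dist_real_def)
      then have "dist (X (min u s)) (X (min u r)) < \<delta> / 2" using u s r t by (intro d(2)) auto
      then show "norm (restrict X {0..s} (min u s) - restrict X {0..r} (min u r)) \<le> \<delta> / 2"
        using u s r t by (simp add: dist_norm)
    qed (use s r t in auto)
    also have "\<dots> < \<delta>" using r(2) by (simp add: dist_real_def abs_minus_commute)
    finally show ?thesis using \<delta>(2)[OF cs[OF r(1)]] by (simp add: dist_real_def)
  qed
  then show "\<exists>d>0. \<forall>x'\<in>{t..T}. dist x' s < d \<longrightarrow> dist (f (path_upto X x')) (f (path_upto X s)) < \<epsilon>"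
    using d(1) \<delta>(1) by (intro exI[of _ "min d (\<delta> / 2)"]) auto
qed

text \<open>The last point at which \<open>y\<close> is at least \<open>y a\<close> must be
  \<open>b\<close>: anywhere earlier, a positive right derivative would produce a later such
  point.\<close>

lemma right_deriv_pos_imp_le:
  fixes y :: "real \<Rightarrow> real"
  assumes ab: "a \<le> b" and y: "continuous_on {a..b} y"
    and D: "\<And>r. a \<le> r \<Longrightarrow> r < b \<Longrightarrow> \<exists>d>0. ((\<lambda>h. (y (r + h) - y r) / h) \<longlongrightarrow> d) (at_right 0)"
  shows "y a \<le> y b"
proof (rule ccontr)
  assume neg: "\<not> y a \<le> y b"
  let ?K = "{a..b} \<inter> y -` {y a..}"
  have "compact ?K"
    using continuous_closed_preimage[OF y closed_atLeastAtMost closed_atLeast, of "y a"]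
    by (simp add: compact_eq_bounded_closed bounded_Int)
  moreover have "?K \<noteq> {}" using ab by auto
  ultimately obtain m where m: "m \<in> ?K" "\<And>r. r \<in> ?K \<Longrightarrow> r \<le> m" by (meson compact_attains_sup)
  with neg have mb: "a \<le> m" "m < b" "y a \<le> y m" by (auto simp: order_le_less)
  obtain d where "d > 0" "((\<lambda>h. (y (m + h) - y m) / h) \<longlongrightarrow> d) (at_right 0)" using D mb by blast
  then have "\<forall>\<^sub>F h in at_right 0. 0 < (y (m + h) - y m) / h" by (auto dest: order_tendstoD)
  then obtain c where c: "c > 0" "\<And>h. 0 < h \<Longrightarrow> h < c \<Longrightarrow> 0 < (y (m + h) - y m) / h"
    unfolding eventually_at_right_field by auto
  define h where "h = min (c / 2) (b - m)"
  have h: "0 < h" "h < c" "m + h \<le> b" using c(1) mb by (auto simp: h_def)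
  with c(2)[of h] have "y m < y (m + h)" by (simp add: zero_less_divide_iff)
  with h mb have "m + h \<in> ?K" by auto
  from m(2)[OF this] h show False by simp
qed

text \<open>A mean value inequality from right derivatives alone. Adding linear terms of slope
  \<open>\<epsilon> - c\<close> to \<open>y\<close> and \<open>\<epsilon> + c\<close> to
  \<open>- y\<close> makes both right derivatives positive.\<close>

lemma right_deriv_bound:
  fixes y :: "real \<Rightarrow> real"
  assumes ab: "a \<le> b" and y: "continuous_on {a..b} y"
    and D: "\<And>r. a \<le> r \<Longrightarrow> r < b \<Longrightarrow> ((\<lambda>h. (y (r + h) - y r) / h) \<longlongrightarrow> D r) (at_right 0)"
    and le: "\<And>r. a \<le> r \<Longrightarrow> r < b \<Longrightarrow> \<bar>D r - c\<bar> < \<epsilon>"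
  shows "\<bar>y b - y a - c * (b - a)\<bar> \<le> \<epsilon> * (b - a)"
proof -
  have q: "((\<lambda>h. (k * y (r + h) + l * (r + h) - (k * y r + l * r)) / h) \<longlongrightarrow> k * D r + l) (at_right 0)"
    if r: "a \<le> r" "r < b" for k l r
  proof (rule Lim_transform_eventually)
    show "((\<lambda>h. k * ((y (r + h) - y r) / h) + l) \<longlongrightarrow> k * D r + l) (at_right 0)"
      by (intro tendsto_intros D r)
    show "\<forall>\<^sub>F h in at_right 0. k * ((y (r + h) - y r) / h) + l = (k * y (r + h) + l * (r + h) - (k * y r + l * r)) / h"
      by (auto simp: eventually_at_filter field_simps)
  qed
  have "y a + (\<epsilon> - c) * a \<le> y b + (\<epsilon> - c) * b"
  proof (rule right_deriv_pos_imp_le[OF ab])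
    show "\<exists>d>0. ((\<lambda>h. (y (r + h) + (\<epsilon> - c) * (r + h) - (y r + (\<epsilon> - c) * r)) / h) \<longlongrightarrow> d) (at_right 0)"
      if "a \<le> r" "r < b" for r
      using q[OF that, of 1 "\<epsilon> - c"] le[OF that] by (intro exI[of _ "D r + (\<epsilon> - c)"]) auto
  qed (intro continuous_intros y)
  moreover have "- y a + (\<epsilon> + c) * a \<le> - y b + (\<epsilon> + c) * b"
  proof (rule right_deriv_pos_imp_le[OF ab])
    show "\<exists>d>0. ((\<lambda>h. (- y (r + h) + (\<epsilon> + c) * (r + h) - (- y r + (\<epsilon> + c) * r)) / h) \<longlongrightarrow> d) (at_right 0)"
      if "a \<le> r" "r < b" for r
      using q[OF that, of "-1" "\<epsilon> + c"] le[OF that] by (intro exI[of _ "- D r + (\<epsilon> + c)"]) auto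
  qed (intro continuous_intros y)
  ultimately show ?thesis by (simp add: abs_le_iff algebra_simps)
qed

section \<open>Frozen extensions and staircase approximation of a ramp\<close>

lemma extend_extend: "0 \<le> s \<Longrightarrow> s \<le> r \<Longrightarrow> r \<le> u \<Longrightarrow> extend r (extend s \<gamma> r) u = extend s \<gamma> u"
  by (auto simp: extend_def restrict_def fun_eq_iff)

lemma extend_self: "\<gamma> \<in> cadlag_paths s \<Longrightarrow> extend s \<gamma> s = \<gamma>"
  unfolding extend_def cadlag_paths_def by (auto simp: fun_eq_iff extensional_def)

lemma bump_0 [simp]: "bump s \<gamma> 0 = \<gamma>"
  by (simp add: bump_def)

lemma bump_bump: "bump s (bump s \<gamma> x) y = bump s \<gamma> (x + y)"
  by (simp add: bump_def add.assoc)

text \<open>Two freezings of the same path differ only by their final times in the path distance, so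
  jumps of \<open>\<gamma>\<close> do no harm.\<close>

lemma extend_continuous:
  assumes f: "f \<in> C0_cadlag T t" and g: "\<gamma> \<in> cadlag_paths s" and s: "0 \<le> s" "t \<le> s"
  shows "continuous_on {s..T} (\<lambda>r. f (r, extend s \<gamma> r))"
  unfolding continuous_on_iff
proof (intro ballI allI impI)
  fix r \<epsilon> :: real assume r: "r \<in> {s..T}" and "0 < \<epsilon>"
  have cs: "(r, extend s \<gamma> r) \<in> cadlag_space T t" if "r \<in> {s..T}" for r
    using that s by (intro cadlag_spaceI extend_cadlag g) auto
  obtain \<delta> where \<delta>: "\<delta> > 0"
    "\<And>q. q \<in> cadlag_space T t \<Longrightarrow> d_infty (r, extend s \<gamma> r) q < \<delta> \<Longrightarrow> \<bar>f q - f (r, extend s \<gamma> r)\<bar> < \<epsilon>"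
    using C0_cadlagE[OF f cs[OF r] \<open>0 < \<epsilon>\<close>] by metis
  have "d_infty (r, extend s \<gamma> r) (r', extend s \<gamma> r') \<le> \<bar>r - r'\<bar> + 0" if "r' \<in> {s..T}" for r'
    using r that s by (intro d_infty_le) (auto simp: extend_apply min.assoc min_absorb2)
  then have "\<bar>f (r', extend s \<gamma> r') - f (r, extend s \<gamma> r)\<bar> < \<epsilon>" if "r' \<in> {s..T}" "\<bar>r - r'\<bar> < \<delta>" for r'
    using that by (intro \<delta>(2) cs) (auto intro: le_less_trans)
  with \<delta>(1) show "\<exists>d>0. \<forall>r'\<in>{s..T}. dist r' r < d \<longrightarrow> dist (f (r', extend s \<gamma> r')) (f (r, extend s \<gamma> r)) < \<epsilon>"
    by (intro exI[of _ \<delta>]) (simp add: dist_real_def abs_minus_commute)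
qed

text \<open>Each step stays frozen for time \<open>\<theta>\<close> and then jumps by
  \<open>\<theta> *\<^sub>R v\<close>, so an increment of a functional splits exactly into a
  horizontal and a vertical move. Jumping at the right end keeps the path right-continuous and puts
  it back on the ramp at each grid time.\<close>

primrec stair :: "real \<Rightarrow> (real \<Rightarrow> real^'n) \<Rightarrow> real^'n \<Rightarrow> real \<Rightarrow> nat \<Rightarrow> real \<Rightarrow> real^'n" where
  "stair s \<gamma> v \<theta> 0 = \<gamma>"
| "stair s \<gamma> v \<theta> (Suc k) = bump (s + \<theta> * real (Suc k))
     (extend (s + \<theta> * real k) (stair s \<gamma> v \<theta> k) (s + \<theta> * real (Suc k))) (\<theta> *\<^sub>R v)"

definition ramp :: "real \<Rightarrow> (real \<Rightarrow> real^'n) \<Rightarrow> real^'n \<Rightarrow> real \<Rightarrow> real^'n" where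
  "ramp s \<gamma> v u = \<gamma> (min u s) + max 0 (u - s) *\<^sub>R v"

lemma stair_cadlag:
  assumes "\<gamma> \<in> cadlag_paths s" "0 \<le> s" "0 \<le> \<theta>"
  shows "stair s \<gamma> v \<theta> k \<in> cadlag_paths (s + \<theta> * real k)"
proof (induction k)
  case (Suc k)
  have "0 \<le> s + \<theta> * real k" "s + \<theta> * real k \<le> s + \<theta> * real (Suc k)" "0 \<le> s + \<theta> * real (Suc k)"
    using assms by (auto simp: algebra_simps)
  with Suc show ?case by (simp only: stair.simps) (intro bump_cadlag extend_cadlag)
qed (use assms in simp)

lemma stair_end:
  assumes "0 \<le> s" "0 \<le> \<theta>"
  shows "stair s \<gamma> v \<theta> k (s + \<theta> * real k) = \<gamma> s + (\<theta> * real k) *\<^sub>R v"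
proof (induction k)
  case (Suc k)
  have "s + \<theta> * real k \<le> s + \<theta> * real (Suc k)" "0 \<le> s + \<theta> * real (Suc k)"
    using assms by (auto simp: algebra_simps)
  with Suc show ?case
    by (simp add: bump_def extend_apply min_absorb2 del: of_nat_Suc) (simp add: algebra_simps)
qed simp

text \<open>The two paths meet at the grid times, and between them the ramp moves by at most
  \<open>\<theta> * norm v\<close>.\<close>

lemma stair_near_ramp:
  assumes \<theta>: "0 \<le> \<theta>" and s: "0 \<le> s" and v: "norm v \<le> 1" and u: "0 \<le> u" "u \<le> s + \<theta> * real k"
  shows "norm (stair s \<gamma> v \<theta> k u - ramp s \<gamma> v u) \<le> \<theta>"
  using u
proof (induction k)
  case 0
  then show ?case using \<theta> by (simp add: ramp_def min_absorb1)
next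
  case (Suc k)
  let ?a = "s + \<theta> * real k" and ?b = "s + \<theta> * real (Suc k)"
  have ab: "?a \<le> ?b" "s \<le> ?a" "?b - ?a = \<theta>" using \<theta> by (auto simp: algebra_simps)
  consider "u = ?b" | "u \<noteq> ?b" "u \<le> ?a" | "?a < u" "u < ?b" using Suc.prems by linarith
  then show ?case
  proof cases
    case 1
    have "ramp s \<gamma> v ?b = stair s \<gamma> v \<theta> (Suc k) ?b"
      unfolding stair_end[OF s \<theta>] using ab by (simp add: ramp_def min_absorb2 del: of_nat_Suc)
    with 1 \<theta> show ?thesis by simp
  next
    case 2
    with Suc ab show ?thesis by (simp add: bump_def extend_apply min_absorb1 del: of_nat_Suc)
  next
    case 3
    then have "stair s \<gamma> v \<theta> (Suc k) u = \<gamma> s + (\<theta> * real k) *\<^sub>R v"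
      using Suc.prems ab by (simp add: bump_def extend_apply min_absorb2 stair_end[OF s \<theta>] del: of_nat_Suc)
    moreover have "ramp s \<gamma> v u = \<gamma> s + (u - s) *\<^sub>R v"
    proof -
      have "s \<le> u" using 3 ab(2) by linarith
      then show ?thesis by (simp add: ramp_def min_absorb2)
    qed
    ultimately have "stair s \<gamma> v \<theta> (Suc k) u - ramp s \<gamma> v u = (?a - u) *\<^sub>R v"
      by (simp add: algebra_simps)
    then have "norm (stair s \<gamma> v \<theta> (Suc k) u - ramp s \<gamma> v u) = (u - ?a) * norm v" using 3 by simp
    also have "\<dots> \<le> \<theta> * 1" using 3 ab v \<theta> by (intro mult_mono) auto
    finally show ?thesis by simp
  qed
qed

text \<open>Covers every path met while a step is being built, with partial freezing up to
  \<open>r\<close> and partial bump \<open>x\<close>. One \<open>r - s\<close> is elapsed time and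
  one the rise of the ramp; one \<open>\<theta>\<close> is the distance to the ramp and one the
  bump.\<close>

lemma stair_near_start:
  assumes \<theta>: "0 \<le> \<theta>" and s: "0 \<le> s" and v: "norm v \<le> 1"
    and r: "s + \<theta> * real k \<le> r" and x: "norm x \<le> \<theta>"
  shows "d_infty (s, \<gamma>) (r, bump r (extend (s + \<theta> * real k) (stair s \<gamma> v \<theta> k) r) x) \<le> 2 * (r - s) + 2 * \<theta>"
proof -
  let ?a = "s + \<theta> * real k"
  have sa: "s \<le> ?a" using \<theta> by simp
  have "d_infty (s, \<gamma>) (r, bump r (extend ?a (stair s \<gamma> v \<theta> k) r) x) \<le> \<bar>s - r\<bar> + ((r - s) + 2 * \<theta>)"
  proof (rule d_infty_le)
    fix u assume u: "0 \<le> u" "u \<le> max s r"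
    define w where "w = min u ?a"
    have w: "0 \<le> w" "w \<le> ?a" "w \<le> r" "min u s = min w s" using u s sa r by (auto simp: w_def)
    define z where "z = (if u = r then x else 0)"
    have "bump r (extend ?a (stair s \<gamma> v \<theta> k) r) x (min u r) = stair s \<gamma> v \<theta> k w + z"
      using u r sa s by (auto simp: bump_def extend_apply w_def z_def)
    then have "\<gamma> (min u s) - bump r (extend ?a (stair s \<gamma> v \<theta> k) r) x (min u r) =
        - (max 0 (w - s) *\<^sub>R v) - ((stair s \<gamma> v \<theta> k w - ramp s \<gamma> v w) + z)"
      unfolding w(4) ramp_def by simp
    also have "norm \<dots> \<le> norm (max 0 (w - s) *\<^sub>R v) + (norm (stair s \<gamma> v \<theta> k w - ramp s \<gamma> v w) + norm z)"
      by (rule order_trans[OF norm_triangle_ineq4]) (simp add: norm_triangle_ineq)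
    also have "\<dots> \<le> (r - s) + (\<theta> + \<theta>)"
    proof (intro add_mono stair_near_ramp \<theta> s v w)
      have "max 0 (w - s) * norm v \<le> (r - s) * 1" using w sa r v by (intro mult_mono) auto
      then show "norm (max 0 (w - s) *\<^sub>R v) \<le> r - s" by simp
      show "norm z \<le> \<theta>" using x \<theta> by (simp add: z_def)
    qed
    finally show "norm (\<gamma> (min u s) - bump r (extend ?a (stair s \<gamma> v \<theta> k) r) x (min u r)) \<le> (r - s) + 2 * \<theta>"
      by simp
  qed (use s sa r in auto)
  also have "\<dots> = 2 * (r - s) + 2 * \<theta>" using sa r by simp
  finally show ?thesis .
qed


text \<open>The horizontal and the vertical move each incur an error of at most
  \<open>\<epsilon> * \<theta>\<close>, since both derivatives stay within \<open>\<epsilon>\<close>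
  of their values at the starting path throughout the step.\<close>

lemma stair_increment:
  fixes h A B :: "'n::finite path \<Rightarrow> real"
  assumes h: "h \<in> C0_cadlag T t" and t: "0 \<le> t"
    and H: "\<And>p. p \<in> cadlag_space T t \<Longrightarrow> fst p < T \<Longrightarrow> has_horizontal_deriv0 h p (A p)"
    and V: "\<And>p. p \<in> cadlag_space T t \<Longrightarrow> has_vertical_deriv h i p (B p)"
    and g: "\<gamma> \<in> cadlag_paths s" and s: "t \<le> s"
    and near: "\<And>q. q \<in> cadlag_space T t \<Longrightarrow> d_infty (s, \<gamma>) q < \<delta> \<Longrightarrow>
       \<bar>A q - A (s, \<gamma>)\<bar> < \<epsilon> \<and> \<bar>B q - B (s, \<gamma>)\<bar> < \<epsilon>"
    and \<theta>: "0 < \<theta>" and k: "s + \<theta> * real (Suc k) \<le> T" "2 * (\<theta> * real (Suc k)) + 2 * \<theta> < \<delta>"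
  defines "P \<equiv> \<lambda>k. (s + \<theta> * real k, stair s \<gamma> (axis i 1) \<theta> k)"
  shows "\<bar>h (P (Suc k)) - h (P k) - (A (s, \<gamma>) + B (s, \<gamma>)) * \<theta>\<bar> \<le> 2 * \<epsilon> * \<theta>"
proof -
  define r0 where "r0 = s + \<theta> * real k"
  define r1 where "r1 = s + \<theta> * real (Suc k)"
  define v :: "real^'n" where "v = axis i 1"
  define Q where "Q = extend r0 (stair s \<gamma> v \<theta> k)"
  have v: "norm v \<le> 1" by (simp add: v_def norm_axis_1)
  have r01: "0 \<le> r0" "s \<le> r0" "r0 < r1" "r1 - r0 = \<theta>" "r1 \<le> T" "r1 - s = \<theta> * real (Suc k)"
    using s t \<theta> k by (auto simp: r0_def r1_def algebra_simps)
  have st: "stair s \<gamma> v \<theta> k \<in> cadlag_paths r0"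
    unfolding r0_def using g s t \<theta> by (intro stair_cadlag) auto
  have Qcs: "(r, bump r (Q r) x) \<in> cadlag_space T t" if "r0 \<le> r" "r \<le> r1" for r x
    unfolding Q_def using that r01 s t by (intro cadlag_spaceI bump_cadlag extend_cadlag st) auto
  have Qnear: "\<bar>A (r, bump r (Q r) x) - A (s, \<gamma>)\<bar> < \<epsilon> \<and> \<bar>B (r, bump r (Q r) x) - B (s, \<gamma>)\<bar> < \<epsilon>"
    if "r0 \<le> r" "r \<le> r1" "norm x \<le> \<theta>" for r x
  proof (rule near[OF Qcs[OF that(1,2)]])
    have "d_infty (s, \<gamma>) (r, bump r (Q r) x) \<le> 2 * (r - s) + 2 * \<theta>"
      unfolding Q_def r0_def using that s t \<theta> v by (intro stair_near_start) (auto simp: r0_def)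
    also have "\<dots> \<le> 2 * (r1 - s) + 2 * \<theta>" using that by simp
    also have "\<dots> < \<delta>" using k(2) r01 by simp
    finally show "d_infty (s, \<gamma>) (r, bump r (Q r) x) < \<delta>" .
  qed
  have "\<bar>h (r1, Q r1) - h (r0, Q r0) - A (s, \<gamma>) * (r1 - r0)\<bar> \<le> \<epsilon> * (r1 - r0)"
  proof (rule right_deriv_bound[where D = "\<lambda>r. A (r, Q r)"])
    have "continuous_on {r0..T} (\<lambda>r. h (r, Q r))"
      unfolding Q_def using s r01 by (intro extend_continuous[OF h] st) auto
    then show "continuous_on {r0..r1} (\<lambda>r. h (r, Q r))"
      by (rule continuous_on_subset) (use r01 in auto)
    fix r assume r: "r0 \<le> r" "r < r1"
    have "((\<lambda>u. (h (r + u, extend r (Q r) (r + u)) - h (r, Q r)) / u) \<longlongrightarrow> A (r, Q r)) (at_right 0)"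
      using H[OF Qcs[of r 0]] r r01 by (simp add: has_horizontal_deriv0_def)
    \<comment> \<open>Freezing an already frozen path changes nothing, so the horizontal derivative
      at \<open>(r, Q r)\<close> is the right derivative of the one-parameter function that
      \<open>right_deriv_bound\<close> needs.\<close>
    moreover have "\<forall>\<^sub>F u in at_right 0. (h (r + u, extend r (Q r) (r + u)) - h (r, Q r)) / u
        = (h (r + u, Q (r + u)) - h (r, Q r)) / u"
      unfolding Q_def using r r01 by (auto simp: eventually_at_filter extend_extend)
    ultimately show "((\<lambda>u. (h (r + u, Q (r + u)) - h (r, Q r)) / u) \<longlongrightarrow> A (r, Q r)) (at_right 0)"
      by (rule Lim_transform_eventually)
    show "\<bar>A (r, Q r) - A (s, \<gamma>)\<bar> < \<epsilon>" using Qnear[of r 0] r \<theta> by simp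
  qed (use r01 in simp)
  moreover have "\<bar>h (r1, bump r1 (Q r1) (\<theta> *\<^sub>R v)) - h (r1, Q r1) - B (s, \<gamma>) * \<theta>\<bar> \<le> \<epsilon> * \<theta>"
  proof -
    let ?z = "\<lambda>x. h (r1, bump r1 (Q r1) (x *\<^sub>R v))"
    \<comment> \<open>Bumps at the same time add up, so the vertical derivative at a bumped path is
      an ordinary derivative along the bump size.\<close>
    have "(?z has_real_derivative B (r1, bump r1 (Q r1) (x *\<^sub>R v))) (at x)" for x
      using V[OF Qcs[of r1 "x *\<^sub>R v"]] r01
      unfolding has_vertical_deriv_def prod.case bump_bump v_def[symmetric] scaleR_left.add[symmetric]
      by (simp add: DERIV_def)
    from MVT2[OF \<theta> this] obtain x where x: "0 < x" "x < \<theta>"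
      "?z \<theta> - ?z 0 = \<theta> * B (r1, bump r1 (Q r1) (x *\<^sub>R v))" by auto
    have "norm (x *\<^sub>R v) \<le> \<theta> * 1" unfolding norm_scaleR using x v \<theta> by (intro mult_mono) auto
    then have "\<bar>B (r1, bump r1 (Q r1) (x *\<^sub>R v)) - B (s, \<gamma>)\<bar> \<le> \<epsilon>"
      using Qnear[of r1 "x *\<^sub>R v"] r01 by simp
    then have "\<theta> * \<bar>B (r1, bump r1 (Q r1) (x *\<^sub>R v)) - B (s, \<gamma>)\<bar> \<le> \<theta> * \<epsilon>"
      using \<theta> by (intro mult_left_mono) auto
    also have "\<theta> * \<bar>B (r1, bump r1 (Q r1) (x *\<^sub>R v)) - B (s, \<gamma>)\<bar> = \<bar>?z \<theta> - ?z 0 - B (s, \<gamma>) * \<theta>\<bar>"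
      using \<theta> unfolding x(3) by (simp add: abs_mult_pos' right_diff_distrib[symmetric] mult.commute)
    finally show ?thesis by (simp add: mult.commute)
  qed
  moreover have "h (P (Suc k)) = h (r1, bump r1 (Q r1) (\<theta> *\<^sub>R v))"
    by (simp add: P_def r1_def r0_def Q_def v_def del: of_nat_Suc)
  moreover have "h (P k) = h (r0, Q r0)"
    using extend_self[OF st] by (simp add: P_def r0_def Q_def v_def)
  ultimately show ?thesis unfolding r01(4) distrib_right abs_le_iff by linarith
qed

lemma vertical_deriv_vanishes:
  fixes h A B :: "'n::finite path \<Rightarrow> real"
  assumes h: "h \<in> C0_cadlag T t" and t: "0 \<le> t" and A: "A \<in> C0_cadlag T t" and B: "B \<in> C0_cadlag T t"
    and H: "\<And>p. p \<in> cadlag_space T t \<Longrightarrow> fst p < T \<Longrightarrow> has_horizontal_deriv0 h p (A p)"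
    and V: "\<And>p. p \<in> cadlag_space T t \<Longrightarrow> has_vertical_deriv h i p (B p)"
    and zero: "\<And>p. p \<in> cont_space T t \<Longrightarrow> h p = 0"
    and p: "(s, \<gamma>) \<in> cont_space T t" and s: "s < T"
  shows "B (s, \<gamma>) = 0"
proof -
  have g: "\<gamma> \<in> cont_paths s" "\<gamma> \<in> cadlag_paths s" "t \<le> s" "0 \<le> s"
    using p t by (auto simp: cont_space_def cont_imp_cadlag)
  have pc: "(s, \<gamma>) \<in> cadlag_space T t" using p cont_space_subset by auto
  define v :: "real^'n" where "v = axis i 1"
  have v: "norm v \<le> 1" by (simp add: v_def norm_axis_1)
  have ramp_cont: "(r, restrict (ramp s \<gamma> (c *\<^sub>R v)) {0..r}) \<in> cont_space T t" if "s \<le> r" "r \<le> T" for r c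
  proof -
    have "continuous_on {0..r} (\<lambda>u. \<gamma> (min u s))"
      by (rule continuous_on_compose2[of "{0..s}" \<gamma>])
        (use g in \<open>auto simp: cont_paths_def intro!: continuous_intros\<close>)
    then have "continuous_on {0..r} (ramp s \<gamma> (c *\<^sub>R v))"
      unfolding ramp_def by (intro continuous_intros)
    then have "restrict (ramp s \<gamma> (c *\<^sub>R v)) {0..r} \<in> cont_paths r" by (intro restrict_cont_paths) auto
    with that g show ?thesis by (simp add: cont_space_def)
  qed
  have "A (s, \<gamma>) = 0"
  proof -
    have ext: "extend s \<gamma> r = restrict (ramp s \<gamma> (0 *\<^sub>R v)) {0..r}" for r
      by (auto simp: extend_def ramp_def min_def fun_eq_iff)
    have "\<forall>\<^sub>F u in at_right 0. (h (s + u, extend s \<gamma> (s + u)) - h (s, \<gamma>)) / u = 0"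
      unfolding eventually_at_right_field
    proof (intro exI[of _ "T - s"] conjI allI impI)
      fix u assume "0 < u" "u < T - s"
      then show "(h (s + u, extend s \<gamma> (s + u)) - h (s, \<gamma>)) / u = 0"
        using zero[OF p] zero[OF ramp_cont[of "s + u" 0]] by (simp only: ext) simp
    qed (use s in simp)
    then have "((\<lambda>u. (h (s + u, extend s \<gamma> (s + u)) - h (s, \<gamma>)) / u) \<longlongrightarrow> 0) (at_right 0)"
      by (rule tendsto_eventually)
    moreover have "((\<lambda>u. (h (s + u, extend s \<gamma> (s + u)) - h (s, \<gamma>)) / u) \<longlongrightarrow> A (s, \<gamma>)) (at_right 0)"
      using H[OF pc] s by (simp add: has_horizontal_deriv0_def)
    ultimately show ?thesis using tendsto_unique[OF trivial_limit_at_right_real] by blast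
  qed
  \<comment> \<open>Two of the three \<open>\<epsilon>\<close> come from the staircase increments,
    the third from replacing the ramp, where \<open>h\<close> vanishes, by the staircase.\<close>
  have "\<bar>A (s, \<gamma>) + B (s, \<gamma>)\<bar> \<le> 3 * \<epsilon>" if \<epsilon>: "0 < \<epsilon>" for \<epsilon>
  proof -
    obtain dA where dA: "dA > 0" "\<And>q. q \<in> cadlag_space T t \<Longrightarrow> d_infty (s, \<gamma>) q < dA \<Longrightarrow> \<bar>A q - A (s, \<gamma>)\<bar> < \<epsilon>"
      using C0_cadlagE[OF A pc \<epsilon>] by metis
    obtain dB where dB: "dB > 0" "\<And>q. q \<in> cadlag_space T t \<Longrightarrow> d_infty (s, \<gamma>) q < dB \<Longrightarrow> \<bar>B q - B (s, \<gamma>)\<bar> < \<epsilon>"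
      using C0_cadlagE[OF B pc \<epsilon>] by metis
    \<comment> \<open>\<open>\<eta>\<close> is the duration of the ramp. Since
      \<open>\<theta> \<le> \<eta>\<close>, all intermediate paths lie within
      \<open>4 * \<eta>\<close> of the start; dividing by 5 makes this strictly less than both
      radii.\<close>
    define \<eta> where "\<eta> = min (T - s) (min dA dB / 5)"
    have "\<eta> \<le> T - s" "\<eta> \<le> min dA dB / 5" unfolding \<eta>_def by (rule min.cobounded1, rule min.cobounded2)
    moreover have "0 < \<eta>" "0 < min dA dB" using s dA(1) dB(1) by (simp_all add: \<eta>_def)
    ultimately have \<eta>: "0 < \<eta>" "s + \<eta> \<le> T" "4 * \<eta> < min dA dB" by linarith+
    let ?R = "(s + \<eta>, restrict (ramp s \<gamma> v) {0..s + \<eta>})"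
    have R: "?R \<in> cont_space T t" using ramp_cont[of "s + \<eta>" 1] \<eta> by simp
    then have Rc: "?R \<in> cadlag_space T t" by (rule subsetD[OF cont_space_subset])
    \<comment> \<open>The tolerance is proportional to \<open>\<eta>\<close> because the final
      estimate is divided by \<open>\<eta>\<close>; hence the ramp is fixed before the step
      size.\<close>
    obtain d where d: "d > 0" "\<And>q. q \<in> cadlag_space T t \<Longrightarrow> d_infty ?R q < d \<Longrightarrow> \<bar>h q - h ?R\<bar> < \<epsilon> * \<eta>"
      using C0_cadlagE[OF h Rc mult_pos_pos[OF \<epsilon> \<eta>(1)]] by metis
    obtain n where n: "\<eta> / d < real n" using reals_Archimedean2 by blast
    have n0: "0 < n" using n \<eta>(1) d(1) by (cases n) (simp_all add: divide_less_0_iff)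
    define \<theta> where "\<theta> = \<eta> / real n"
    have \<theta>: "0 < \<theta>" "\<theta> * real n = \<eta>" using n0 \<eta>(1) by (simp_all add: \<theta>_def)
    have \<theta>d: "\<theta> < d" using n n0 d(1) by (simp add: \<theta>_def divide_less_eq mult.commute)
    have \<theta>\<eta>: "\<theta> * 1 \<le> \<eta>" unfolding \<theta>(2)[symmetric] using \<theta>(1) n0 by (intro mult_left_mono) auto
    define P where "P = (\<lambda>k. (s + \<theta> * real k, stair s \<gamma> v \<theta> k))"
    have "\<bar>h (P k) - (A (s, \<gamma>) + B (s, \<gamma>)) * \<theta> * real k\<bar> \<le> 2 * \<epsilon> * \<theta> * real k" if "k \<le> n" for k
      using that
    proof (induction k)
      case 0
      then show ?case using zero[OF p] by (simp add: P_def)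
    next
      case (Suc k)
      have "\<theta> * real (Suc k) \<le> \<theta> * real n" using Suc.prems \<theta>(1) by (intro mult_left_mono) auto
      then have k\<eta>: "\<theta> * real (Suc k) \<le> \<eta>" by (simp only: \<theta>(2))
      have "\<bar>h (P (Suc k)) - h (P k) - (A (s, \<gamma>) + B (s, \<gamma>)) * \<theta>\<bar> \<le> 2 * \<epsilon> * \<theta>"
        unfolding P_def v_def
      proof (rule stair_increment[where h = h and T = T and t = t and A = A and B = B and i = i
            and \<gamma> = \<gamma> and s = s and k = k and \<epsilon> = \<epsilon> and \<theta> = \<theta> and \<delta> = "min dA dB"])
        show "s + \<theta> * real (Suc k) \<le> T" "2 * (\<theta> * real (Suc k)) + 2 * \<theta> < min dA dB"
          using k\<eta> \<eta> \<theta>\<eta> by linarith+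
      qed (use dA(2) dB(2) in \<open>auto intro: h t H V g \<theta>(1)\<close>)
      with Suc show ?case by (simp add: algebra_simps abs_le_iff)
    qed
    from this[of n] have "\<bar>h (P n) - (A (s, \<gamma>) + B (s, \<gamma>)) * \<eta>\<bar> \<le> 2 * \<epsilon> * \<eta>"
      using \<theta>(2) by (simp add: mult.assoc)
    moreover have "\<bar>h (P n)\<bar> < \<epsilon> * \<eta>"
    proof -
      have Pn: "P n = (s + \<eta>, stair s \<gamma> v \<theta> n)" by (simp add: P_def \<theta>(2))
      have st: "stair s \<gamma> v \<theta> n \<in> cadlag_paths (s + \<eta>)"
        using stair_cadlag[OF g(2,4), of \<theta> v n] \<theta> by simp
      have "d_infty ?R (P n) \<le> \<bar>(s + \<eta>) - (s + \<eta>)\<bar> + \<theta>"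
        unfolding Pn
      proof (rule d_infty_le)
        fix u assume "0 \<le> u" "u \<le> max (s + \<eta>) (s + \<eta>)"
        then show "norm (restrict (ramp s \<gamma> v) {0..s + \<eta>} (min u (s + \<eta>)) - stair s \<gamma> v \<theta> n (min u (s + \<eta>))) \<le> \<theta>"
          using stair_near_ramp[of \<theta> s v u n \<gamma>] \<theta> g v by (simp add: norm_minus_commute min_absorb1)
      qed (use g \<eta> in auto)
      then have "d_infty ?R (P n) < d" using \<theta>d by simp
      moreover have "P n \<in> cadlag_space T t"
        unfolding Pn using st \<eta> g by (intro cadlag_spaceI) auto
      ultimately show ?thesis using d(2) zero[OF R] by fastforce
    qed
    ultimately have "\<bar>(A (s, \<gamma>) + B (s, \<gamma>)) * \<eta>\<bar> \<le> 3 * \<epsilon> * \<eta>" unfolding distrib_right abs_le_iff abs_less_iff by linarith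
    then show ?thesis using \<eta>(1) by (simp add: abs_mult)
  qed
  \<comment> \<open>With this \<open>\<epsilon>\<close> a nonzero sum would be bounded by half of
    itself.\<close>
  from this[of "\<bar>A (s, \<gamma>) + B (s, \<gamma>)\<bar> / 6"] have "A (s, \<gamma>) + B (s, \<gamma>) = 0"
    by (cases "A (s, \<gamma>) + B (s, \<gamma>) = 0") auto
  with \<open>A (s, \<gamma>) = 0\<close> show ?thesis by simp
qed

section \<open>Independence of the extension on continuous paths\<close>

lemma has_horizontal_deriv0_of_C1:
  assumes "f \<in> C1_cadlag T t" "p \<in> cadlag_space T t" "fst p < T"
  shows "has_horizontal_deriv0 f p (horizontal_deriv T f p)"
proof -
  have "\<exists>D. has_horizontal_deriv T f p D" using assms by (simp add: C1_cadlag_def)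
  then obtain D where D: "has_horizontal_deriv T f p D" ..
  with assms(3) have "has_horizontal_deriv0 f p D"
    by (cases p) (simp add: has_horizontal_deriv_def)
  with horizontal_derivI[OF D] show ?thesis by simp
qed

lemma has_vertical_deriv_of_C1:
  assumes "f \<in> C1_cadlag T t" "p \<in> cadlag_space T t"
  shows "has_vertical_deriv f i p (vertical_deriv f p $ i)"
proof -
  have "\<exists>D. has_vertical_deriv f i p D" using assms by (simp add: C1_cadlag_def)
  then obtain D where D: "has_vertical_deriv f i p D" ..
  with vertical_derivI[OF D] show ?thesis by simp
qed

lemma has_horizontal_deriv0_diff:
  assumes "has_horizontal_deriv0 f p D" "has_horizontal_deriv0 g p E"
  shows "has_horizontal_deriv0 (\<lambda>p. f p - g p) p (D - E)"
proof (cases p)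
  case (Pair s \<gamma>)
  have "((\<lambda>h. (f (s + h, extend s \<gamma> (s + h)) - f (s, \<gamma>)) / h - (g (s + h, extend s \<gamma> (s + h)) - g (s, \<gamma>)) / h) \<longlongrightarrow> D - E) (at_right 0)"
    using assms by (intro tendsto_diff) (auto simp: has_horizontal_deriv0_def Pair)
  then show ?thesis by (simp add: has_horizontal_deriv0_def Pair diff_divide_distrib add_divide_distrib algebra_simps)
qed

lemma has_vertical_deriv_diff:
  assumes "has_vertical_deriv f i p D" "has_vertical_deriv g i p E"
  shows "has_vertical_deriv (\<lambda>p. f p - g p) i p (D - E)"
proof (cases p)
  case (Pair s \<gamma>)
  have "((\<lambda>h. (f (s, bump s \<gamma> (h *\<^sub>R axis i 1)) - f (s, \<gamma>)) / h - (g (s, bump s \<gamma> (h *\<^sub>R axis i 1)) - g (s, \<gamma>)) / h) \<longlongrightarrow> D - E) (at 0)"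
    using assms by (intro tendsto_diff) (auto simp: has_vertical_deriv_def Pair)
  then show ?thesis by (simp add: has_vertical_deriv_def Pair diff_divide_distrib add_divide_distrib algebra_simps)
qed

lemma vertical_deriv_unique_on_cont_space:
  fixes f g :: "'n::finite path \<Rightarrow> real"
  assumes f: "f \<in> C1_cadlag T t" and g: "g \<in> C1_cadlag T t" and t: "0 \<le> t" "t < T"
    and eq: "\<And>p. p \<in> cont_space T t \<Longrightarrow> f p = g p" and p: "p \<in> cont_space T t"
  shows "vertical_deriv f p = vertical_deriv g p"
proof (subst vec_eq_iff, rule allI)
  fix i
  define B where "B = (\<lambda>p. vertical_deriv f p $ i - vertical_deriv g p $ i)"
  have B: "B \<in> C0_cadlag T t"
    unfolding B_def using f g by (intro C0_cadlag_diff) (auto simp: C1_cadlag_def)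
  have zero: "B (s, \<gamma>) = 0" if "(s, \<gamma>) \<in> cont_space T t" "s < T" for s \<gamma>
  proof (rule vertical_deriv_vanishes[OF _ t(1) _ B _ _ _ that])
    show "(\<lambda>p. f p - g p) \<in> C0_cadlag T t" "(\<lambda>p. horizontal_deriv T f p - horizontal_deriv T g p) \<in> C0_cadlag T t"
      using f g by (auto simp: C1_cadlag_def intro!: C0_cadlag_diff)
  qed (use f g eq in \<open>auto simp: B_def intro!: has_horizontal_deriv0_diff has_vertical_deriv_diff
      has_horizontal_deriv0_of_C1 has_vertical_deriv_of_C1\<close>)
  obtain s \<gamma> where s: "p = (s, \<gamma>)" by (cases p)
  have "B p = 0"
  proof (cases "s < T")
    case True
    with zero p s show ?thesis by simp
  next
    case False
    \<comment> \<open>No ramp fits after the final time, so the value at \<open>T\<close> is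
      obtained as the limit along initial segments of the same path.\<close>
    with p s have sT: "s = T" and \<gamma>: "\<gamma> \<in> cont_paths T" by (auto simp: cont_space_def)
    have pT: "p = path_upto \<gamma> T"
      using \<gamma> by (simp add: s sT path_upto_def cont_paths_def extensional_restrict)
    have cont: "continuous_on {0..T} \<gamma>" using \<gamma> by (simp add: cont_paths_def)
    have "((\<lambda>r. B (path_upto \<gamma> r)) \<longlongrightarrow> B (path_upto \<gamma> T)) (at T within {t..T})"
      using path_upto_continuous[OF cont B t(1)] t by (auto simp: continuous_on)
    then have "((\<lambda>r. B (path_upto \<gamma> r)) \<longlongrightarrow> B (path_upto \<gamma> T)) (at_left T)"
      using t by (simp add: at_within_Icc_at_left)
    moreover have "((\<lambda>r. B (path_upto \<gamma> r)) \<longlongrightarrow> 0) (at_left T)"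
    proof (rule tendsto_eventually)
      show "\<forall>\<^sub>F r in at_left T. B (path_upto \<gamma> r) = 0"
        unfolding eventually_at_left_field
      proof (intro exI[of _ t] conjI allI impI)
        fix r assume "t < r" "r < T"
        then show "B (path_upto \<gamma> r) = 0"
          using zero[of r] path_upto_cont_space[OF cont, of t r] by (simp add: path_upto_def)
      qed (rule t)
    qed
    ultimately have "B (path_upto \<gamma> T) = 0" using tendsto_unique[OF trivial_limit_at_left_real] by blast
    then show ?thesis by (simp add: pT)
  qed
  then show "vertical_deriv f p $ i = vertical_deriv g p $ i" by (simp add: B_def)
qed

section \<open>Stieltjes integrals with absolutely continuous integrators\<close>

text \<open>
  Greedy grouping: a maximal subset of weight below \<open>\<delta>\<close> has weight at least \<open>\<delta> / 2\<close>, unless it is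
  everything.
\<close>

lemma sum_le_of_small_sums:
  fixes w f :: "'a \<Rightarrow> real"
  assumes D: "finite D" and w: "\<And>K. K \<in> D \<Longrightarrow> w K < \<delta> / 2"
    and small: "\<And>E. E \<subseteq> D \<Longrightarrow> sum w E < \<delta> \<Longrightarrow> sum f E \<le> 1"
    and n: "sum w D \<le> real n * (\<delta> / 2)" and \<delta>: "0 < \<delta>"
  shows "sum f D \<le> real n + 1"
  using D w small n
proof (induction n arbitrary: D)
  case 0
  then show ?case using \<delta> by simp
next
  case (Suc n)
  let ?A = "{E. E \<subseteq> D \<and> sum w E < \<delta>}"
  have "finite ?A" using Suc.prems(1) by simp
  moreover have "{} \<in> ?A" using \<delta> by simp
  ultimately have "\<exists>E\<in>?A. \<forall>F\<in>?A. E \<subseteq> F \<longrightarrow> E = F" by (intro finite_has_maximal) auto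
  then obtain E where E: "E \<in> ?A" "\<And>F. F \<in> ?A \<Longrightarrow> E \<subseteq> F \<Longrightarrow> E = F" by meson
  then have fE: "finite E" "E \<subseteq> D" using Suc.prems(1) finite_subset by auto
  show ?case
  proof (cases "E = D")
    case True
    with Suc.prems(3)[of D] E(1) show ?thesis by simp
  next
    case False
    with fE obtain K where K: "K \<in> D" "K \<notin> E" by blast
    have "\<delta> \<le> sum w (insert K E)"
    proof (rule ccontr)
      assume "\<not> \<delta> \<le> sum w (insert K E)"
      then have "insert K E \<in> ?A" using K(1) fE(2) by simp
      from E(2)[OF this] K(2) show False by auto
    qed
    then have "\<delta> / 2 \<le> sum w E" using K fE(1) Suc.prems(2)[of K] by simp
    moreover have "sum w D = sum w (D - E) + sum w E"
      using sum.subset_diff[OF fE(2) Suc.prems(1)] .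
    ultimately have "sum w (D - E) \<le> real n * (\<delta> / 2)" using Suc.prems(4) by (simp add: algebra_simps)
    then have "sum f (D - E) \<le> real n + 1"
      by (intro Suc.IH) (use Suc.prems in auto)
    moreover have "sum f D = sum f (D - E) + sum f E"
      using sum.subset_diff[OF fE(2) Suc.prems(1)] .
    moreover have "sum f E \<le> 1" using Suc.prems(3) E(1) by simp
    ultimately show ?thesis by simp
  qed
qed

lemma division_of_real_interval:
  fixes K :: "real set"
  assumes "D division_of A" "K \<in> D"
  shows "Inf K \<le> Sup K" "x \<in> K \<longleftrightarrow> Inf K \<le> x \<and> x \<le> Sup K" "measure lborel K = Sup K - Inf K"
proof -
  obtain c d where K: "K = cbox c d" "K \<noteq> {}" using division_ofD(3,4)[OF assms(1) assms(2)] by blast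
  then have cd: "c \<le> d" by simp
  show "Inf K \<le> Sup K" "x \<in> K \<longleftrightarrow> Inf K \<le> x \<and> x \<le> Sup K" "measure lborel K = Sup K - Inf K"
    unfolding K(1) using cd by simp_all
qed

text \<open>Absolute continuity with tolerance 1 bounds the variation over families of small total
  length; grouping splits a fine division into boundedly many such families. The mesh returned is
  half the original \<open>\<delta>\<close>, as the grouping requires.\<close>

lemma abs_continuous_on_bounded_variation:
  fixes X :: "real \<Rightarrow> real^'n"
  assumes X: "abs_continuous_on u v X" and uv: "u \<le> v"
  obtains V \<delta> where "0 < \<delta>" and
    "\<forall>D A. D division_of A \<and> A \<subseteq> {u..v} \<and> (\<forall>K\<in>D. Sup K - Inf K < \<delta>) \<longrightarrow>
       (\<Sum>K\<in>D. norm (X (Sup K) - X (Inf K))) \<le> V"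
proof -
  have "\<exists>\<delta>>0. \<forall>D A. D division_of A \<and> A \<subseteq> {u..v} \<and> (\<Sum>K\<in>D. Sup K - Inf K) < \<delta> \<longrightarrow>
     (\<Sum>K\<in>D. norm (X (Sup K) - X (Inf K))) < 1"
    using X unfolding abs_continuous_on_def by (elim allE[of _ 1]) simp
  then obtain \<delta> where \<delta>: "\<delta> > 0" and AC: "\<forall>D A. D division_of A \<and> A \<subseteq> {u..v} \<and> (\<Sum>K\<in>D. Sup K - Inf K) < \<delta> \<longrightarrow>
     (\<Sum>K\<in>D. norm (X (Sup K) - X (Inf K))) < 1"
    by (elim exE conjE)
  obtain n where n: "(v - u) / (\<delta> / 2) < real n" using reals_Archimedean2 by blast
  then have n: "v - u \<le> real n * (\<delta> / 2)" using \<delta> by (simp add: divide_less_eq)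
  show thesis
  proof (intro that allI impI)
    show "0 < \<delta> / 2" using \<delta> by simp
    fix D A assume "D division_of A \<and> A \<subseteq> {u..v} \<and> (\<forall>K\<in>D. Sup K - Inf K < \<delta> / 2)"
    then have D: "D division_of A" "A \<subseteq> {u..v}" "\<And>K. K \<in> D \<Longrightarrow> Sup K - Inf K < \<delta> / 2" by auto
    show "(\<Sum>K\<in>D. norm (X (Sup K) - X (Inf K))) \<le> real n + 1"
    proof (rule sum_le_of_small_sums[where w = "\<lambda>K. Sup K - Inf K" and \<delta> = \<delta>])
      show "finite D" using D(1) by blast
      fix E assume E: "E \<subseteq> D" "(\<Sum>K\<in>E. Sup K - Inf K) < \<delta>"
      have "E division_of \<Union>E"
        using D(1) E(1) division_of_subset[of D E] division_ofD(6)[OF D(1)] by simp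
      moreover have "\<Union>E \<subseteq> {u..v}" using D(2) E(1) division_ofD(6)[OF D(1)] by blast
      ultimately have "E division_of \<Union>E \<and> \<Union>E \<subseteq> {u..v} \<and> (\<Sum>K\<in>E. Sup K - Inf K) < \<delta>"
        by (intro conjI E(2))
      from AC[rule_format, OF this] show "(\<Sum>K\<in>E. norm (X (Sup K) - X (Inf K))) \<le> 1" by simp
    next
      have "measure lborel K = Sup K - Inf K" if "K \<in> D" for K
        by (rule division_of_real_interval(3)[OF D(1) that])
      then have "(\<Sum>K\<in>D. Sup K - Inf K) = sum (measure lborel) D" by simp
      also have "\<dots> \<le> measure lborel (cbox u v)" using D(1,2) by (intro subadditive_content_division) auto
      also have "\<dots> = v - u" using uv by simp
      finally show "(\<Sum>K\<in>D. Sup K - Inf K) \<le> real n * (\<delta> / 2)" using n by simp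
    qed (use D \<delta> in auto)
  qed
qed

text \<open>Cutting each interval at \<open>w K\<close> again yields a division, to which the
  variation bound applies. Intervals cut down to a point contribute 0 and are dropped, which makes
  the cutting map injective.\<close>

lemma sum_subinterval_increments_le:
  fixes X :: "real \<Rightarrow> real^'n"
  assumes BV: "\<forall>D A. D division_of A \<and> A \<subseteq> {u..v} \<and> (\<forall>K\<in>D. Sup K - Inf K < \<delta>) \<longrightarrow>
       (\<Sum>K\<in>D. norm (X (Sup K) - X (Inf K))) \<le> V"
    and D: "D division_of A" "A \<subseteq> {u..v}" "\<And>K. K \<in> D \<Longrightarrow> Sup K - Inf K < \<delta>"
    and w: "\<And>K. K \<in> D \<Longrightarrow> w K \<in> K"
  shows "(\<Sum>K\<in>D. norm (X (w K) - X (Inf K))) \<le> V"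
proof -
  define J where "J = (\<lambda>K. {Inf K..w K})"
  define D1 where "D1 = {K \<in> D. Inf K < w K}"
  have K: "Inf K \<le> w K" "w K \<le> Sup K" if "K \<in> D" for K
    using w[OF that] division_of_real_interval(2)[OF D(1) that] by auto
  have J: "J K \<subseteq> K" if "K \<in> D" for K
  proof
    fix x assume "x \<in> J K"
    then have "Inf K \<le> x" "x \<le> Sup K" using K[OF that] by (auto simp: J_def)
    then show "x \<in> K" using division_of_real_interval(2)[OF D(1) that, of x] by simp
  qed
  have disj: "interior (J K) \<inter> interior (J L) = {}" if "K \<in> D" "L \<in> D" "K \<noteq> L" for K L
    using division_ofD(5)[OF D(1) that] interior_mono[OF J[OF that(1)]] interior_mono[OF J[OF that(2)]] by blast
  have inj: "inj_on J D1"
  proof (rule inj_onI, rule ccontr)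
    fix K L assume KL: "K \<in> D1" "L \<in> D1" "J K = J L" "K \<noteq> L"
    with disj[of K L] have "interior (J K) = {}" by (auto simp: D1_def)
    with KL(1) show False by (simp add: J_def D1_def)
  qed
  have fin: "finite D" using D(1) by blast
  have "(\<Sum>K\<in>D. norm (X (w K) - X (Inf K))) = (\<Sum>K\<in>D1. norm (X (w K) - X (Inf K)))"
  proof (rule sum.mono_neutral_right[OF fin])
    show "\<forall>K\<in>D - D1. norm (X (w K) - X (Inf K)) = 0"
    proof
      fix L assume "L \<in> D - D1"
      then have "w L = Inf L" using K(1)[of L] by (simp add: D1_def)
      then show "norm (X (w L) - X (Inf L)) = 0" by simp
    qed
  qed (auto simp: D1_def)
  also have "\<dots> = (\<Sum>K\<in>D1. norm (X (Sup (J K)) - X (Inf (J K))))"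
    by (intro sum.cong refl) (auto simp: J_def D1_def)
  also have "\<dots> = (\<Sum>K\<in>J ` D1. norm (X (Sup K) - X (Inf K)))"
    using inj by (simp add: sum.reindex)
  also have "\<dots> \<le> V"
  proof (rule BV[rule_format, OF conjI[OF _ conjI[OF _ ballI]]])
    show "J ` D1 division_of \<Union>(J ` D1)"
    proof (rule division_ofI)
      show "finite (J ` D1)" using fin by (simp add: D1_def)
      fix L assume L: "L \<in> J ` D1"
      then show "L \<subseteq> \<Union>(J ` D1)" by blast
      from L obtain K where "K \<in> D1" "L = J K" by blast
      then show "L \<noteq> {}" "\<exists>a b. L = cbox a b" by (auto simp: J_def D1_def)
      fix L' assume "L' \<in> J ` D1" "L \<noteq> L'"
      with L disj show "interior L \<inter> interior L' = {}" unfolding D1_def by blast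
    qed simp
    show "\<Union>(J ` D1) \<subseteq> {u..v}" using J D(2) division_ofD(2)[OF D(1)] by (fastforce simp: D1_def)
    fix L assume "L \<in> J ` D1"
    then obtain K where "K \<in> D" "Inf K < w K" "L = {Inf K..w K}" by (auto simp: J_def D1_def)
    with K(2) D(3) show "Sup L - Inf L < \<delta>" by fastforce
  qed
  finally show ?thesis .
qed

text \<open>On a fine mesh, uniform continuity of \<open>X\<close> turns each squared increment into
  a small multiple of the increment itself, and bounded variation sums these. Uniform continuity of
  \<open>F\<close> pays for replacing the right endpoint by an arbitrary tag. The free point
  \<open>w\<close> leaves room for functionals that depend on a running maximum.\<close>

lemma has_stieltjes_integral_of_increments:
  fixes X F :: "real \<Rightarrow> real^'n" and \<phi> :: "real \<Rightarrow> real"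
  assumes X: "continuous_on {u..v} X" and F: "continuous_on {u..v} F" and ac: "abs_continuous_on u v X"
    and uv: "u \<le> v" and C: "0 < C"
    and inc: "\<And>c d. u \<le> c \<Longrightarrow> c \<le> d \<Longrightarrow> d \<le> v \<Longrightarrow> \<exists>w\<in>{c..d}.
      \<bar>\<phi> d - \<phi> c - F d \<bullet> (X d - X c)\<bar> \<le> C * ((norm (X d - X c))\<^sup>2 + (norm (X w - X c))\<^sup>2)"
  shows "has_stieltjes_integral F X u v (\<phi> v - \<phi> u)"
  unfolding has_stieltjes_integral_def
proof (intro allI impI)
  fix \<epsilon> :: real assume \<epsilon>: "0 < \<epsilon>"
  obtain V \<delta>0 where \<delta>0: "0 < \<delta>0" and BV: "\<forall>D A. D division_of A \<and> A \<subseteq> {u..v} \<and> (\<forall>K\<in>D. Sup K - Inf K < \<delta>0) \<longrightarrow>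
       (\<Sum>K\<in>D. norm (X (Sup K) - X (Inf K))) \<le> V"
    by (rule abs_continuous_on_bounded_variation[OF ac uv])
  have V: "0 \<le> V" using BV[rule_format, of "{}" "{}"] by simp
  \<comment> \<open>Two sums of increments, each at most \<open>V\<close>, will be multiplied by
    \<open>e\<close>; the 1 covers \<open>V = 0\<close>.\<close>
  define e where "e = \<epsilon> / (2 * V + 1)"
  have e: "0 < e" "e * (V + V) < \<epsilon>" using \<epsilon> V by (simp_all add: e_def field_simps)
  have uX: "uniformly_continuous_on {u..v} X" and uF: "uniformly_continuous_on {u..v} F"
    using X F by (simp_all add: compact_uniformly_continuous)
  \<comment> \<open>The first tolerance gives \<open>C * x\<^sup>2 \<le> e / 2 * x\<close> for
    increments of size \<open>x\<close>; the second leaves the other \<open>e / 2\<close> for the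
    oscillation of \<open>F\<close>.\<close>
  have pos: "0 < e / (2 * C)" "0 < e / 2" using e C by simp_all
  from uX[unfolded uniformly_continuous_on_def, rule_format, OF pos(1)]
  obtain \<delta>1 where \<delta>1: "0 < \<delta>1"
    "\<And>x y. x \<in> {u..v} \<Longrightarrow> y \<in> {u..v} \<Longrightarrow> dist y x < \<delta>1 \<Longrightarrow> dist (X y) (X x) < e / (2 * C)" by meson
  from uF[unfolded uniformly_continuous_on_def, rule_format, OF pos(2)]
  obtain \<delta>2 where \<delta>2: "0 < \<delta>2"
    "\<And>x y. x \<in> {u..v} \<Longrightarrow> y \<in> {u..v} \<Longrightarrow> dist y x < \<delta>2 \<Longrightarrow> dist (F y) (F x) < e / 2" by meson
  define \<delta> where "\<delta> = min \<delta>0 (min \<delta>1 \<delta>2)"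
  define Q where "Q = (\<lambda>c d w. w \<in> {c..d} \<and>
      \<bar>\<phi> d - \<phi> c - F d \<bullet> (X d - X c)\<bar> \<le> C * ((norm (X d - X c))\<^sup>2 + (norm (X w - X c))\<^sup>2))"
  define w where "w = (\<lambda>c d. SOME x. Q c d x)"
  have "Q c d (w c d)" if "u \<le> c" "c \<le> d" "d \<le> v" for c d
    unfolding w_def using inc[OF that] by (intro someI_ex[of "Q c d"]) (auto simp: Q_def)
  then have w: "w c d \<in> {c..d}"
      "\<bar>\<phi> d - \<phi> c - F d \<bullet> (X d - X c)\<bar> \<le> C * ((norm (X d - X c))\<^sup>2 + (norm (X (w c d) - X c))\<^sup>2)"
    if "u \<le> c" "c \<le> d" "d \<le> v" for c d
    using that by (simp_all add: Q_def)
  define W where "W = (\<lambda>K::real set. w (Inf K) (Sup K))"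
  have local: "\<bar>F \<xi> \<bullet> (X d - X c) - (\<phi> d - \<phi> c)\<bar> \<le> e * (norm (X d - X c) + norm (X (w c d) - X c))"
    if cd: "u \<le> c" "c \<le> d" "d \<le> v" "d - c < \<delta>" and \<xi>: "\<xi> \<in> {c..d}" for c d \<xi>
  proof -
    have sq: "C * (norm (X x - X c))\<^sup>2 \<le> e / 2 * norm (X x - X c)" if "x \<in> {c..d}" for x
    proof -
      have "dist (X x) (X c) < e / (2 * C)"
        using that cd by (intro \<delta>1(2)) (auto simp: \<delta>_def dist_real_def)
      then have "C * norm (X x - X c) \<le> e / 2" using C by (simp add: dist_norm field_simps)
      then have "C * norm (X x - X c) * norm (X x - X c) \<le> e / 2 * norm (X x - X c)"
        by (rule mult_right_mono) simp
      then show ?thesis by (simp add: power2_eq_square mult.assoc)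
    qed
    have wcd: "w c d \<in> {c..d}" by (rule w(1)[OF cd(1-3)])
    have "dist (F \<xi>) (F d) < e / 2"
      using \<xi> cd by (intro \<delta>2(2)) (auto simp: \<delta>_def dist_real_def)
    then have "norm (F \<xi> - F d) \<le> e / 2" by (simp add: dist_norm)
    then have "\<bar>(F \<xi> - F d) \<bullet> (X d - X c)\<bar> \<le> e / 2 * norm (X d - X c)"
      by (intro order_trans[OF Cauchy_Schwarz_ineq2] mult_right_mono) auto
    moreover have "\<bar>\<phi> d - \<phi> c - F d \<bullet> (X d - X c)\<bar> \<le> C * (norm (X d - X c))\<^sup>2 + C * (norm (X (w c d) - X c))\<^sup>2"
      using w(2)[OF cd(1-3)] by (simp only: distrib_left)
    moreover have "C * (norm (X d - X c))\<^sup>2 \<le> e / 2 * norm (X d - X c)" using sq cd by simp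
    moreover have "C * (norm (X (w c d) - X c))\<^sup>2 \<le> e / 2 * norm (X (w c d) - X c)" using sq wcd by simp
    moreover have "0 \<le> e / 2 * norm (X (w c d) - X c)" using e by simp
    ultimately show ?thesis unfolding inner_diff_left distrib_left by (simp only: abs_le_iff) linarith
  qed
  show "\<exists>\<delta>>0. \<forall>P. P tagged_division_of {u..v} \<and> (\<forall>(\<xi>, K)\<in>P. Sup K - Inf K < \<delta>) \<longrightarrow>
     \<bar>(\<Sum>(\<xi>, K)\<in>P. F \<xi> \<bullet> (X (Sup K) - X (Inf K))) - (\<phi> v - \<phi> u)\<bar> < \<epsilon>"
  proof (intro exI[of _ \<delta>] conjI allI impI, goal_cases)
    case 1
    show ?case using \<delta>0 \<delta>1(1) \<delta>2(1) by (simp add: \<delta>_def)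
  next
    case (2 P)
    then have P: "P tagged_division_of {u..v}" and mesh: "\<And>\<xi> K. (\<xi>, K) \<in> P \<Longrightarrow> Sup K - Inf K < \<delta>" by auto
    let ?D = "snd ` P"
    have D: "?D division_of {u..v}" using P by (rule division_of_tagged_division)
    have K: "Inf K \<le> Sup K" "u \<le> Inf K" "Sup K \<le> v" "Sup K - Inf K < \<delta>"
      and mem: "x \<in> K \<longleftrightarrow> Inf K \<le> x \<and> x \<le> Sup K" if "K \<in> ?D" for K x
    proof -
      show K: "Inf K \<le> Sup K" by (rule division_of_real_interval[OF D that])
      show mem: "x \<in> K \<longleftrightarrow> Inf K \<le> x \<and> x \<le> Sup K" for x by (rule division_of_real_interval[OF D that])
      show "u \<le> Inf K" "Sup K \<le> v"
        using division_ofD(2)[OF D that] mem[of "Inf K"] mem[of "Sup K"] K by auto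
      show "Sup K - Inf K < \<delta>" using that mesh by auto
    qed
    have conv: "(\<Sum>(\<xi>, K)\<in>P. norm (X (W' K) - X (Inf K))) = (\<Sum>K\<in>?D. norm (X (W' K) - X (Inf K)))"
      if W': "\<And>K. K \<in> ?D \<Longrightarrow> W' K \<in> K" for W'
    proof -
      \<comment> \<open>The default 0 is needed because \<open>W'\<close> is known to land in
        \<open>K\<close> only for intervals of the division; on degenerate intervals the increment
        vanishes, as passing from tagged intervals to intervals requires.\<close>
      let ?d = "\<lambda>K. if K \<in> ?D then norm (X (W' K) - X (Inf K)) else 0"
      have "(\<Sum>(\<xi>, K)\<in>P. ?d K) = sum ?d ?D"
      proof (rule sum.over_tagged_division_lemma[OF P])
        fix a b :: real assume "box a b = {}"
        then have "W' (cbox a b) = Inf (cbox a b)" if "cbox a b \<in> ?D"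
          using W'[OF that] K(1)[OF that] by (cases "a = b") auto
        then show "?d (cbox a b) = 0" by simp
      qed
      moreover have "(\<Sum>(\<xi>, K)\<in>P. ?d K) = (\<Sum>(\<xi>, K)\<in>P. norm (X (W' K) - X (Inf K)))"
        by (rule sum.cong) force+
      ultimately show ?thesis by simp
    qed
    have W: "W K \<in> K" "Sup K \<in> K" if "K \<in> ?D" for K
      using w(1)[OF K(2,1,3)[OF that]] K(1)[OF that] by (simp_all add: W_def mem[OF that])
    have bound: "(\<Sum>(\<xi>, K)\<in>P. norm (X (W' K) - X (Inf K))) \<le> V" if W': "\<And>K. K \<in> ?D \<Longrightarrow> W' K \<in> K" for W'
    proof -
      have "(\<Sum>(\<xi>, K)\<in>P. norm (X (W' K) - X (Inf K))) = (\<Sum>K\<in>?D. norm (X (W' K) - X (Inf K)))"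
        using W' by (rule conv)
      also have "\<dots> \<le> V"
      proof (rule sum_subinterval_increments_le[OF BV D order_refl])
        show "Sup K - Inf K < \<delta>0" if "K \<in> ?D" for K using K(4)[OF that] by (simp add: \<delta>_def)
      qed (rule W')
      finally show ?thesis .
    qed
    have "(\<Sum>(\<xi>, K)\<in>P. F \<xi> \<bullet> (X (Sup K) - X (Inf K))) - (\<phi> v - \<phi> u)
        = (\<Sum>(\<xi>, K)\<in>P. F \<xi> \<bullet> (X (Sup K) - X (Inf K)) - (\<phi> (Sup K) - \<phi> (Inf K)))"
      unfolding additive_tagged_division_1[OF uv P, of \<phi>, symmetric] sum_subtractf[symmetric]
      by (intro sum.cong) auto
    also have "\<bar>\<dots>\<bar> \<le> (\<Sum>(\<xi>, K)\<in>P. \<bar>F \<xi> \<bullet> (X (Sup K) - X (Inf K)) - (\<phi> (Sup K) - \<phi> (Inf K))\<bar>)"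
      by (intro order_trans[OF sum_abs]) (simp add: case_prod_unfold)
    also have "\<dots> \<le> (\<Sum>(\<xi>, K)\<in>P. e * (norm (X (Sup K) - X (Inf K)) + norm (X (W K) - X (Inf K))))"
    proof (rule sum_mono, clarify)
      fix \<xi> K assume xK: "(\<xi>, K) \<in> P"
      then have KD: "K \<in> ?D" by force
      have "\<xi> \<in> K" using P xK by blast
      then have "\<xi> \<in> {Inf K..Sup K}" using mem[OF KD] by simp
      then show "\<bar>F \<xi> \<bullet> (X (Sup K) - X (Inf K)) - (\<phi> (Sup K) - \<phi> (Inf K))\<bar>
          \<le> e * (norm (X (Sup K) - X (Inf K)) + norm (X (W K) - X (Inf K)))"
        unfolding W_def by (intro local K KD)
    qed
    also have "\<dots> = e * ((\<Sum>(\<xi>, K)\<in>P. norm (X (Sup K) - X (Inf K))) + (\<Sum>(\<xi>, K)\<in>P. norm (X (W K) - X (Inf K))))"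
      by (simp add: case_prod_unfold sum.distrib[symmetric] sum_distrib_left)
    also have "\<dots> \<le> e * (V + V)" using e W by (intro mult_left_mono add_mono bound) auto
    also have "\<dots> < \<epsilon>" by (rule e)
    finally show ?case .
  qed
qed

lemma has_stieltjes_integral_unique:
  assumes I: "has_stieltjes_integral F X u v I" and J: "has_stieltjes_integral F X u v J"
  shows "I = J"
proof (rule ccontr)
  assume "I \<noteq> J"
  then have e: "\<bar>I - J\<bar> / 2 > 0" by simp
  let ?S = "\<lambda>P. \<Sum>(\<xi>, K)\<in>P. F \<xi> \<bullet> (X (Sup K) - X (Inf K))"
  obtain \<delta>1 where \<delta>1: "\<delta>1 > 0" "\<And>P. P tagged_division_of {u..v} \<Longrightarrow> (\<forall>(\<xi>, K)\<in>P. Sup K - Inf K < \<delta>1) \<Longrightarrow>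
     \<bar>?S P - I\<bar> < \<bar>I - J\<bar> / 2" using I e unfolding has_stieltjes_integral_def by meson
  obtain \<delta>2 where \<delta>2: "\<delta>2 > 0" "\<And>P. P tagged_division_of {u..v} \<Longrightarrow> (\<forall>(\<xi>, K)\<in>P. Sup K - Inf K < \<delta>2) \<Longrightarrow>
     \<bar>?S P - J\<bar> < \<bar>I - J\<bar> / 2" using J e unfolding has_stieltjes_integral_def by meson
  define \<delta> where "\<delta> = min \<delta>1 \<delta>2"
  have \<delta>: "\<delta> > 0" using \<delta>1(1) \<delta>2(1) by (simp add: \<delta>_def)
  \<comment> \<open>Existence of a tagged division fine for balls of radius
    \<open>\<delta> / 2\<close> supplies one Riemann sum of mesh below \<open>\<delta>\<close> that
    must be close to both values.\<close>
  have "gauge (\<lambda>x. ball x (\<delta> / 2))" using \<delta> by (simp add: gauge_ball)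
  then obtain P where P: "P tagged_division_of {u..v}" "(\<lambda>x. ball x (\<delta> / 2)) fine P"
    by (rule fine_division_exists_real)
  have mesh: "Sup K - Inf K < \<delta>" if xK: "(\<xi>, K) \<in> P" for \<xi> K
  proof -
    have KD: "K \<in> snd ` P" using xK by force
    have "Inf K \<in> K" "Sup K \<in> K"
      using division_of_real_interval[OF division_of_tagged_division[OF P(1)] KD] by simp_all
    moreover have "K \<subseteq> ball \<xi> (\<delta> / 2)" using P(2) xK by (auto simp: fine_def)
    ultimately have "dist \<xi> (Inf K) < \<delta> / 2" "dist \<xi> (Sup K) < \<delta> / 2" by auto
    then show ?thesis unfolding dist_real_def by linarith
  qed
  have "\<bar>I - J\<bar> \<le> \<bar>?S P - I\<bar> + \<bar>?S P - J\<bar>" by linarith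
  also have "\<dots> < \<bar>I - J\<bar> / 2 + \<bar>I - J\<bar> / 2"
    using mesh by (intro add_strict_mono \<delta>1(2)[OF P(1)] \<delta>2(2)[OF P(1)]) (force simp: \<delta>_def)+
  finally show False by simp
qed

section \<open>The increment formula for S\<close>

text \<open>With \<open>N\<close> fixed the numerator is quadratic in \<open>q\<close>, the change
  of the squared norm. The remainder is \<open>q\<^sup>2 - 2 * p * b\<close> over
  \<open>N\<^sup>2\<close>; both terms carry a factor \<open>N\<^sup>2\<close>, so the bound is
  uniform in \<open>N\<close>, with 6 arising as 4 + 2.\<close>

lemma S_quotient_taylor:
  fixes y z :: "'b::real_inner"
  assumes y: "norm y \<le> N" and z: "norm z \<le> N"
  shows "\<bar>(N\<^sup>2 - (norm z)\<^sup>2)\<^sup>2 / N\<^sup>2 - (N\<^sup>2 - (norm y)\<^sup>2)\<^sup>2 / N\<^sup>2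
     - ((- (4 * (N\<^sup>2 - (norm y)\<^sup>2)) / N\<^sup>2) *\<^sub>R y) \<bullet> (z - y)\<bar> \<le> 6 * (norm (z - y))\<^sup>2"
proof (cases "N = 0")
  case False
  then have N: "N\<^sup>2 > 0" by simp
  define p where "p = N\<^sup>2 - (norm y)\<^sup>2"
  define q where "q = (norm z)\<^sup>2 - (norm y)\<^sup>2"
  define b where "b = (norm (z - y))\<^sup>2"
  have b: "0 \<le> b" by (simp add: b_def)
  have p: "0 \<le> p" "p \<le> N\<^sup>2" using y by (auto simp: p_def intro: power_mono)
  have "z = y + (z - y)" by simp
  then have "(norm z)\<^sup>2 = (norm y)\<^sup>2 + 2 * (y \<bullet> (z - y)) + b"
    unfolding b_def power2_norm_eq_inner by (simp add: inner_diff_left inner_diff_right inner_commute)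
  then have qy: "q = 2 * (y \<bullet> (z - y)) + b" by (simp add: q_def)
  have "q\<^sup>2 = (norm z - norm y)\<^sup>2 * (norm z + norm y)\<^sup>2"
    unfolding q_def by (simp add: power2_eq_square algebra_simps)
  also have "\<dots> \<le> b * (2 * N)\<^sup>2"
  proof (intro mult_mono)
    show "(norm z - norm y)\<^sup>2 \<le> b"
      unfolding b_def by (rule power2_le_iff_abs_le[THEN iffD2]) (simp_all add: norm_triangle_ineq3)
    show "(norm z + norm y)\<^sup>2 \<le> (2 * N)\<^sup>2" using y z by (intro power_mono) auto
  qed (use b in auto)
  finally have q: "q\<^sup>2 \<le> 4 * (N\<^sup>2 * b)" by (simp add: power2_eq_square algebra_simps)
  have "(N\<^sup>2 - (norm z)\<^sup>2)\<^sup>2 / N\<^sup>2 - (N\<^sup>2 - (norm y)\<^sup>2)\<^sup>2 / N\<^sup>2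
     - ((- (4 * (N\<^sup>2 - (norm y)\<^sup>2)) / N\<^sup>2) *\<^sub>R y) \<bullet> (z - y) = ((p - q)\<^sup>2 - p\<^sup>2 + 2 * p * (q - b)) / N\<^sup>2"
  proof -
    have 1: "N\<^sup>2 - (norm z)\<^sup>2 = p - q" by (simp add: p_def q_def)
    have 2: "y \<bullet> (z - y) = (q - b) / 2" using qy by simp
    show ?thesis unfolding p_def[symmetric] 1 inner_scaleR_left 2 using N by (simp add: field_simps)
  qed
  also have "(p - q)\<^sup>2 - p\<^sup>2 + 2 * p * (q - b) = q\<^sup>2 - 2 * p * b"
    by (simp add: power2_eq_square algebra_simps)
  also have "\<bar>(q\<^sup>2 - 2 * p * b) / N\<^sup>2\<bar> = \<bar>q\<^sup>2 - 2 * p * b\<bar> / N\<^sup>2" by (simp add: abs_divide)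
  also have "\<dots> \<le> (6 * b * N\<^sup>2) / N\<^sup>2"
  proof (rule divide_right_mono)
    have "p * b \<le> N\<^sup>2 * b" "0 \<le> p * b" using p b by (auto intro: mult_right_mono)
    moreover have "0 \<le> q\<^sup>2" by simp
    moreover have "2 * p * b = 2 * (p * b)" "6 * b * N\<^sup>2 = 6 * (N\<^sup>2 * b)" by simp_all
    ultimately show "\<bar>q\<^sup>2 - 2 * p * b\<bar> \<le> 6 * b * N\<^sup>2" using q unfolding abs_le_iff by linarith
  qed simp
  also have "\<dots> = 6 * b" using N by simp
  finally show ?thesis by (simp add: b_def)
qed simp

text \<open>In the factored difference of squares, \<open>N + norm y \<le> 2 * N\<close> cancels the
  denominator up to the constant 4. What remains is quadratic in the excess of the maximum over the
  current distance.\<close>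

lemma S_quotient_bounds:
  fixes y :: "'b::real_normed_vector"
  assumes y: "norm y \<le> N"
  shows "0 \<le> (N\<^sup>2 - (norm y)\<^sup>2)\<^sup>2 / N\<^sup>2" "(N\<^sup>2 - (norm y)\<^sup>2)\<^sup>2 / N\<^sup>2 \<le> 4 * (N - norm y)\<^sup>2"
proof -
  have "(N\<^sup>2 - (norm y)\<^sup>2)\<^sup>2 = (N - norm y)\<^sup>2 * (N + norm y)\<^sup>2"
    by (simp add: power2_eq_square algebra_simps)
  also have "\<dots> \<le> (N - norm y)\<^sup>2 * (2 * N)\<^sup>2"
    using y order_trans[OF norm_ge_zero y] by (intro mult_left_mono power_mono) auto
  finally have "(N\<^sup>2 - (norm y)\<^sup>2)\<^sup>2 / N\<^sup>2 \<le> (N - norm y)\<^sup>2 * (2 * N)\<^sup>2 / N\<^sup>2" by (rule divide_right_mono) simp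
  also have "\<dots> \<le> 4 * (N - norm y)\<^sup>2" by (cases "N = 0") (simp_all add: power_mult_distrib)
  finally show "(N\<^sup>2 - (norm y)\<^sup>2)\<^sup>2 / N\<^sup>2 \<le> 4 * (N - norm y)\<^sup>2" .
qed simp

text \<open>
  If the running maximum \<open>dev\<close> grows between times \<open>c\<close> and \<open>d\<close>, it is attained at some
  \<open>w \<in> [c, d]\<close>, so that \<open>dev\<close> exceeds the current distance at \<open>c\<close> by at most
  \<open>|X(w) - X(c)|\<close>; since \<open>S\<close> is quadratic in that excess, the growth of the maximum contributes
  only second-order terms.
\<close>

lemma S_from_increment:
  fixes X :: "real \<Rightarrow> real^'n"
  assumes t0: "0 \<le> t0" and a: "a \<in> cont_paths t0" and X: "continuous_on {0..T} X"
    and cd: "t0 \<le> c" "c \<le> d" "d \<le> T"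
  shows "\<exists>w\<in>{c..d}. \<bar>S_from t0 a (path_upto X d) - S_from t0 a (path_upto X c)
       - S_grad t0 a (path_upto X d) \<bullet> (X d - X c)\<bar>
     \<le> 6 * ((norm (X d - X c))\<^sup>2 + (norm (X w - X c))\<^sup>2)"
proof -
  have ac: "a \<in> cadlag_paths t0" using a by (rule cont_imp_cadlag)
  have cad: "restrict X {0..r} \<in> cadlag_paths r" if "r \<le> T" for r
    using X that by (intro cont_imp_cadlag restrict_cont_paths)
  define N where "N = (\<lambda>r. dev t0 a (path_upto X r))"
  define y where "y = (\<lambda>r. X r - a t0)"
  define \<Psi> :: "real \<Rightarrow> real^'n \<Rightarrow> real" where "\<Psi> = (\<lambda>n x. (n\<^sup>2 - (norm x)\<^sup>2)\<^sup>2 / n\<^sup>2)"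
  have gap: "gap t0 a (path_upto X r) = y r" if "t0 \<le> r" for r
    using that t0 by (simp add: gap_def path_upto_def y_def)
  have yN: "norm (y r) \<le> N r" if "t0 \<le> r" "r \<le> T" for r
    using gap_le_dev[OF t0 ac cad that(1)] that gap[OF that(1)] by (simp add: N_def path_upto_def)
  have S: "S_from t0 a (path_upto X r) = \<Psi> (N r) (y r)" if "t0 \<le> r" for r
    using S_from_eq[OF t0 ac that, of "restrict X {0..r}"] gap[OF that]
    by (simp add: \<Psi>_def N_def path_upto_def)
  have f_le: "norm (X x - a (min x t0)) \<le> N r" if "0 \<le> x" "x \<le> r" "t0 \<le> r" "r \<le> T" for x r
    using dev_upper[OF t0 ac cad[OF that(4)] that(3,1)] that by (simp add: N_def path_upto_def min_absorb1)
  have N_le: "N r \<le> M" if "t0 \<le> r" "\<And>x. 0 \<le> x \<Longrightarrow> x \<le> r \<Longrightarrow> norm (X x - a (min x t0)) \<le> M" for r M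
    unfolding N_def path_upto_def using that t0 by (intro dev_least[OF t0 ac]) auto
  have Ncd: "N c \<le> N d" using f_le[of _ d] cd by (intro N_le) auto
  \<comment> \<open>The increment is split in two: here the maximum changes with the gap held at
    \<open>y c\<close>; afterwards the gap moves with the maximum held at
    \<open>N d\<close>.\<close>
  obtain w where w: "w \<in> {c..d}" "\<bar>\<Psi> (N d) (y c) - \<Psi> (N c) (y c)\<bar> \<le> 4 * (norm (X w - X c))\<^sup>2"
  proof (cases "N c = N d")
    case True
    then show ?thesis using that[of c] cd by simp
  next
    case False
    have "continuous_on {0..d} X" by (rule continuous_on_subset[OF X]) (use cd in auto)
    moreover have "continuous_on {0..d} (\<lambda>x. a (min x t0))"
      by (rule continuous_on_compose2[of "{0..t0}" a])
        (use a t0 in \<open>auto simp: cont_paths_def intro!: continuous_intros\<close>)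
    ultimately have "continuous_on {0..d} (\<lambda>x. norm (X x - a (min x t0)))" by (intro continuous_intros)
    then have "\<exists>w\<in>{0..d}. \<forall>x\<in>{0..d}. norm (X x - a (min x t0)) \<le> norm (X w - a (min w t0))"
      using cd t0 by (intro continuous_attains_sup) auto
    then obtain w where w: "w \<in> {0..d}"
      "\<And>x. x \<in> {0..d} \<Longrightarrow> norm (X x - a (min x t0)) \<le> norm (X w - a (min w t0))" by auto
    have Nd: "N d \<le> norm (X w - a (min w t0))" using w(2) cd by (intro N_le) auto
    have wc: "c < w"
    proof (rule ccontr)
      \<comment> \<open>A maximiser no later than \<open>c\<close> would already be counted in
        \<open>N c\<close>, contradicting the growth of the maximum.\<close>
      assume "\<not> c < w"
      then have "norm (X w - a (min w t0)) \<le> N c" using w(1) cd by (intro f_le) auto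
      with Nd Ncd False show False by simp
    qed
    have "N d \<le> norm (y w)" using Nd wc cd by (simp add: y_def min_absorb2)
    also have "\<dots> \<le> norm (y c) + norm (X w - X c)"
      using norm_triangle_ineq[of "y c" "X w - X c"] by (simp add: y_def)
    finally have "N d - norm (y c) \<le> norm (X w - X c)" by simp
    then have sq: "(N d - norm (y c))\<^sup>2 \<le> (norm (X w - X c))\<^sup>2"
      using yN[of c] Ncd cd by (intro power_mono) auto
    have sq': "(N c - norm (y c))\<^sup>2 \<le> (N d - norm (y c))\<^sup>2"
      using yN[of c] Ncd cd by (intro power_mono) auto
    have "\<bar>\<Psi> (N d) (y c) - \<Psi> (N c) (y c)\<bar> \<le> 4 * (norm (X w - X c))\<^sup>2"
      using S_quotient_bounds[of "y c" "N d"] S_quotient_bounds[of "y c" "N c"] yN[of c] Ncd cd sq sq'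
      unfolding \<Psi>_def abs_le_iff by linarith
    with wc w(1) show ?thesis by (intro that[of w]) auto
  qed
  \<comment> \<open>The expansion is made at the right endpoint because \<open>N d\<close> dominates
    both gaps, as the Taylor estimate requires.\<close>
  have "\<bar>\<Psi> (N d) (y c) - \<Psi> (N d) (y d) - S_grad t0 a (path_upto X d) \<bullet> (y c - y d)\<bar> \<le> 6 * (norm (y c - y d))\<^sup>2"
  proof -
    have "S_grad t0 a (path_upto X d) = (- (4 * ((N d)\<^sup>2 - (norm (y d))\<^sup>2)) / (N d)\<^sup>2) *\<^sub>R y d"
      unfolding S_grad_def N_def gap[OF order_trans[OF cd(1,2)]] ..
    then show ?thesis
      using yN[of c] yN[of d] Ncd cd by (simp only: \<Psi>_def) (intro S_quotient_taylor; simp)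
  qed
  moreover have "norm (y c - y d) = norm (X d - X c)" by (simp add: y_def norm_minus_commute)
  moreover have "S_grad t0 a (path_upto X d) \<bullet> (y c - y d) = - (S_grad t0 a (path_upto X d) \<bullet> (X d - X c))"
    by (simp add: y_def inner_diff_right)
  moreover have "0 \<le> (norm (X w - X c))\<^sup>2" by simp
  ultimately have "\<bar>S_from t0 a (path_upto X d) - S_from t0 a (path_upto X c)
       - S_grad t0 a (path_upto X d) \<bullet> (X d - X c)\<bar>
     \<le> 6 * ((norm (X d - X c))\<^sup>2 + (norm (X w - X c))\<^sup>2)"
    using w(2) cd S[of c] S[of d] unfolding distrib_left abs_le_iff by (simp only:) linarith
  with w(1) show ?thesis by blast
qed

lemma abs_continuous_on_subset:
  "abs_continuous_on u v X \<Longrightarrow> s \<le> v \<Longrightarrow> abs_continuous_on u s X"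
  unfolding abs_continuous_on_def by (meson atLeastatMost_subset_iff order_refl order_trans)

text \<open>The chosen extension is unknown, but \<open>S_from\<close> is itself defined on cadlag
  paths and extends its own restriction, so uniqueness transfers its explicit gradient.\<close>

lemma vertical_deriv_cont_S_from:
  fixes a :: "real \<Rightarrow> real^'n"
  assumes t: "0 \<le> t0" "t0 < T" and a: "a \<in> cont_paths t0" and p: "p \<in> cont_space T t0"
  shows "vertical_deriv_cont T t0 (S_from t0 a) p = S_grad t0 a p"
proof -
  have ac: "a \<in> cadlag_paths t0" using a by (rule cont_imp_cadlag)
  let ?g = "SOME g. C1_extension T t0 (S_from t0 a) g"
  have S: "S_from t0 a \<in> C1_cadlag T t0" by (rule S_from_C1[OF t(1) ac t(2)])
  then have "C1_extension T t0 (S_from t0 a) (S_from t0 a)" by (simp add: C1_extension_def)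
  then have g: "C1_extension T t0 (S_from t0 a) ?g" by (rule someI[of "C1_extension T t0 (S_from t0 a)"])
  then have "vertical_deriv ?g p = vertical_deriv (S_from t0 a) p"
    using S t p by (intro vertical_deriv_unique_on_cont_space[of _ T t0]) (auto simp: C1_extension_def)
  also have "\<dots> = S_grad t0 a p"
  proof (subst vec_eq_iff, rule allI)
    fix i
    have "p \<in> cadlag_space T t0" using p cont_space_subset by blast
    then show "vertical_deriv (S_from t0 a) p $ i = S_grad t0 a p $ i"
      by (cases p) (auto intro!: vertical_derivI S_from_vertical[OF t(1) ac])
  qed
  finally show ?thesis by (simp add: vertical_deriv_cont_def)
qed

lemma S_from_has_stieltjes_integral:
  fixes a X :: "real \<Rightarrow> real^'n"
  assumes t: "0 \<le> t0" "t0 < T" and a: "a \<in> cont_paths t0"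
    and X: "continuous_on {0..T} X" and AC: "abs_continuous_on t0 T X" and s: "t0 \<le> s" "s \<le> T"
  shows "has_stieltjes_integral (\<lambda>\<sigma>. vertical_deriv_cont T t0 (S_from t0 a) (path_upto X \<sigma>)) X t0 s
    (S_from t0 a (path_upto X s) - S_from t0 a (path_upto X t0))"
proof -
  let ?F = "\<lambda>\<sigma>. vertical_deriv_cont T t0 (S_from t0 a) (path_upto X \<sigma>)"
  have F: "?F \<sigma> = S_grad t0 a (path_upto X \<sigma>)" if "\<sigma> \<in> {t0..T}" for \<sigma>
    using that X t a by (intro vertical_deriv_cont_S_from path_upto_cont_space) auto
  have "continuous_on {t0..T} (\<lambda>\<sigma>. \<chi> i. S_grad t0 a (path_upto X \<sigma>) $ i)"
    using path_upto_continuous[OF X S_grad_C0[OF t(1) cont_imp_cadlag[OF a]] t(1)]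
    by (intro continuous_on_vec_lambda)
  then have "continuous_on {t0..T} ?F"
    by (rule continuous_on_eq) (simp add: F)
  then have cF: "continuous_on {t0..s} ?F" by (rule continuous_on_subset) (use s in auto)
  have cX: "continuous_on {t0..s} X" by (rule continuous_on_subset[OF X]) (use s t a in auto)
  have ac: "abs_continuous_on t0 s X" using abs_continuous_on_subset[OF AC s(2)] .
  show "has_stieltjes_integral ?F X t0 s
      (S_from t0 a (path_upto X s) - S_from t0 a (path_upto X t0))"
  proof (rule has_stieltjes_integral_of_increments[OF cX cF ac s(1), where C = 6])
    fix c d assume "t0 \<le> c" "c \<le> d" "d \<le> s"
    with s show "\<exists>w\<in>{c..d}. \<bar>S_from t0 a (path_upto X d) - S_from t0 a (path_upto X c) - ?F d \<bullet> (X d - X c)\<bar>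
      \<le> 6 * ((norm (X d - X c))\<^sup>2 + (norm (X w - X c))\<^sup>2)"
      using S_from_increment[OF t(1) a X, of c d] F[of d] by simp
  qed simp
qed

theorem lemma2p10:
  fixes T t0 :: real and a :: "real \<Rightarrow> real^'n"
  assumes "0 < T" and "0 \<le> t0" and "t0 < T" and "a \<in> cont_paths t0"
  shows "g_from t0 a \<in> C1_cont T t0 \<and>
    S_from t0 a \<in> C1_cont T t0 \<and>
    (\<forall>X :: real \<Rightarrow> real^'n. continuous_on {0..T} X \<and> abs_continuous_on t0 T X \<longrightarrow>
      (\<forall>s\<in>{t0..T}.
        g_from t0 a (path_upto X s) =
          g_from t0 a (path_upto X t0) + (LBINT \<sigma>:{t0..s}. (norm (X \<sigma> - a t0))\<^sup>2)) \<and>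
      (\<forall>s\<in>{t0..T}.
        stieltjes_integrable
          (\<lambda>\<sigma>. vertical_deriv_cont T t0 (S_from t0 a) (path_upto X \<sigma>)) X t0 s \<and>
        S_from t0 a (path_upto X s) =
          S_from t0 a (path_upto X t0) +
          stieltjes_integral
            (\<lambda>\<sigma>. vertical_deriv_cont T t0 (S_from t0 a) (path_upto X \<sigma>)) X t0 s)) \<and>
    (\<forall>(t, \<gamma>)\<in>cont_space T t0. \<forall>i.
      vertical_deriv_cont T t0 (S_from t0 a) (t, \<gamma>) $ i =
        (let N = sup_norm t (\<lambda>s. \<gamma> s - extend t0 a t s) in
         if N \<noteq> 0
         then - (4 * (N\<^sup>2 - (norm (\<gamma> t - a t0))\<^sup>2) * (\<gamma> t $ i - a t0 $ i)) / N\<^sup>2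
         else 0))"
proof (intro conjI allI impI ballI, goal_cases)
  case 1
  show ?case
    using g_from_C1[OF assms(2) cont_imp_cadlag[OF assms(4)] assms(3)]
    by (auto simp: C1_cont_def C1_extension_def)
next
  case 2
  show ?case
    using S_from_C1[OF assms(2) cont_imp_cadlag[OF assms(4)] assms(3)]
    by (auto simp: C1_cont_def C1_extension_def)
next
  case (3 X s)
  then show ?case
    using assms by (intro g_from_path cont_imp_cadlag restrict_cont_paths[of T]) auto
next
  case (4 X s)
  then show ?case
    using S_from_has_stieltjes_integral[OF assms(2-4), of X s] by (auto simp: stieltjes_integrable_def)
next
  case (5 X s)
  let ?F = "\<lambda>\<sigma>. vertical_deriv_cont T t0 (S_from t0 a) (path_upto X \<sigma>)"
  have I: "has_stieltjes_integral ?F X t0 s (S_from t0 a (path_upto X s) - S_from t0 a (path_upto X t0))"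
    using 5 by (intro S_from_has_stieltjes_integral assms) auto
  have "stieltjes_integral ?F X t0 s = S_from t0 a (path_upto X s) - S_from t0 a (path_upto X t0)"
    unfolding stieltjes_integral_def
    by (rule the_equality) (rule I, erule has_stieltjes_integral_unique[OF _ I])
  then show ?case by simp
next
  case 6
  \<comment> \<open>The zero branch of the formula is division by zero in
    \<open>S_grad_nth\<close>.\<close>
  then show ?case
    using vertical_deriv_cont_S_from[OF assms(2-4)]
    by (auto simp: S_grad_nth dev_def gap_def Let_def)
qed

end
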